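(* Let $(A,B)$ be a concave monotone pair in $\mathbb{M}_n$ and let $\Phi:\mathbb{M}_n\to\mathbb{M}_d$ be a unital positive linear map. Then there exists a unitary $V\in\mathbb{M}_d$ such that $$|\Phi(A)\Phi(B)|\le\frac{\Phi(AB)+V\Phi(AB)V^*}{2}.$$
   Context: $\mathbb{M}_n$ is the algebra of $n\times n$ complex matrices. A pair $(A,B)$ of matrices in $\mathbb{M}_n$ is a monotone pair if there exist a positive semidefinite $C\in\mathbb{M}_n$ and two non-negative, non-decreasing functions $f,g$ on $[0,\infty)$ such that $A=f(C)$ and $B=g(C)$ (functional calculus). A monotone pair $(A,B)$ is concave if $A=h(B)$ for some concave function $h:[0,\infty)\to[0,\infty)$. A linear map $\Phi$ is positive if it maps positive semidefinite matrices to positive semidefinite matrices, and unital if $\Phi(I)=I$. $|X|=(X^*X)^{1/2}$, and $\le$ is the Loewner order on Hermitian matrices. *)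

theory Defs
  imports
    "HOL-Analysis.Convex"
    "HOL-Library.FuncSet"
    "Jordan_Normal_Form.Schur_Decomposition"
begin

definition hermitian_mat :: "nat \<Rightarrow> complex mat \<Rightarrow> bool" where
  "hermitian_mat n A \<longleftrightarrow> A \<in> carrier_mat n n \<and> mat_adjoint A = A"

definition unitary_mat :: "nat \<Rightarrow> complex mat \<Rightarrow> bool" where
  "unitary_mat n U \<longleftrightarrow>
     U \<in> carrier_mat n n \<and> mat_adjoint U * U = 1\<^sub>m n \<and> U * mat_adjoint U = 1\<^sub>m n"

(* The order on complex is that of Complex_Order: 0 \<le> z means that z is real and non-negative. *)
definition psd_mat :: "nat \<Rightarrow> complex mat \<Rightarrow> bool" where
  "psd_mat n A \<longleftrightarrow> hermitian_mat n A \<and> (\<forall>v \<in> carrier_vec n. 0 \<le> (A *\<^sub>v v) \<bullet>c v)"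

definition loewner_le :: "nat \<Rightarrow> complex mat \<Rightarrow> complex mat \<Rightarrow> bool" where
  "loewner_le n A B \<longleftrightarrow> hermitian_mat n A \<and> hermitian_mat n B \<and> psd_mat n (B - A)"

definition real_diag :: "nat \<Rightarrow> (nat \<Rightarrow> real) \<Rightarrow> complex mat" where
  "real_diag n d = mat_diag n (\<lambda>i. complex_of_real (d i))"

(* f(C) = U diag(f(d_0),...,f(d_(n-1))) U^* for any unitary diagonalisation
   C = U diag(d_0,...,d_(n-1)) U^* of a Hermitian C. Lemma fun_calc_unitary_diag below shows that
   the result does not depend on the diagonalisation. If C is not Hermitian there is no such
   diagonalisation, and the value is unspecified. *)
definition fun_calc :: "(real \<Rightarrow> real) \<Rightarrow> complex mat \<Rightarrow> complex mat" where
  "fun_calc f C = (THE X. \<exists>U d. unitary_mat (dim_row C) U \<and>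
      C = U * real_diag (dim_row C) d * mat_adjoint U \<and>
      X = U * real_diag (dim_row C) (f \<circ> d) * mat_adjoint U)"

definition abs_mat :: "complex mat \<Rightarrow> complex mat" where
  "abs_mat X = fun_calc sqrt (mat_adjoint X * X)"

definition monotone_pair :: "nat \<Rightarrow> complex mat \<Rightarrow> complex mat \<Rightarrow> bool" where
  "monotone_pair n A B \<longleftrightarrow>
     (\<exists>C f g. psd_mat n C \<and>
        f \<in> {0..} \<rightarrow> {0..} \<and> mono_on {0..} f \<and>
        g \<in> {0..} \<rightarrow> {0..} \<and> mono_on {0..} g \<and>
        A = fun_calc f C \<and> B = fun_calc g C)"

definition concave_monotone_pair :: "nat \<Rightarrow> complex mat \<Rightarrow> complex mat \<Rightarrow> bool" where
  "concave_monotone_pair n A B \<longleftrightarrow>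
     monotone_pair n A B \<and>
     (\<exists>h. h \<in> {0..} \<rightarrow> {0..} \<and> concave_on {0..} h \<and> A = fun_calc h B)"

definition linear_mat_map :: "nat \<Rightarrow> nat \<Rightarrow> (complex mat \<Rightarrow> complex mat) \<Rightarrow> bool" where
  "linear_mat_map n d \<Phi> \<longleftrightarrow>
     \<Phi> \<in> carrier_mat n n \<rightarrow> carrier_mat d d \<and>
     (\<forall>X \<in> carrier_mat n n. \<forall>Y \<in> carrier_mat n n. \<Phi> (X + Y) = \<Phi> X + \<Phi> Y) \<and>
     (\<forall>c. \<forall>X \<in> carrier_mat n n. \<Phi> (c \<cdot>\<^sub>m X) = c \<cdot>\<^sub>m \<Phi> X)"

definition positive_mat_map :: "nat \<Rightarrow> nat \<Rightarrow> (complex mat \<Rightarrow> complex mat) \<Rightarrow> bool" where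
  "positive_mat_map n d \<Phi> \<longleftrightarrow> (\<forall>X. psd_mat n X \<longrightarrow> psd_mat d (\<Phi> X))"

definition unital_mat_map :: "nat \<Rightarrow> nat \<Rightarrow> (complex mat \<Rightarrow> complex mat) \<Rightarrow> bool" where
  "unital_mat_map n d \<Phi> \<longleftrightarrow> \<Phi> (1\<^sub>m n) = 1\<^sub>m d"

lemma mat_adjoint_carrier [simp]:
  "A \<in> carrier_mat n m \<Longrightarrow> mat_adjoint A \<in> carrier_mat m n"
  by (rule carrier_matI) (simp_all add: mat_adjoint_def)

lemma real_diag_carrier [simp]: "real_diag n d \<in> carrier_mat n n"
  unfolding real_diag_def by simp

lemma fun_calc_unique:
  assumes U: "unitary_mat n U" and V: "unitary_mat n V"
    and eq: "U * real_diag n d * mat_adjoint U = V * real_diag n e * mat_adjoint V"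
  shows "U * real_diag n (f \<circ> d) * mat_adjoint U = V * real_diag n (f \<circ> e) * mat_adjoint V"
proof -
  let ?W = "mat_adjoint V * U"
  have c [simp]: "U \<in> carrier_mat n n" "V \<in> carrier_mat n n"
      "mat_adjoint U \<in> carrier_mat n n" "mat_adjoint V \<in> carrier_mat n n"
    using U V by (auto simp: unitary_mat_def)
  have mult_c [simp]: "X * Y \<in> carrier_mat n n"
    if "X \<in> carrier_mat n n" "Y \<in> carrier_mat n n" for X Y :: "complex mat"
    using that by (rule mult_carrier_mat)
  note assoc = assoc_mult_mat[of _ n n _ n _ n]
  note one = left_mult_one_mat[of _ n n] right_mult_one_mat[of _ n n]
  note unit = U[unfolded unitary_mat_def] V[unfolded unitary_mat_def]
  have W: "?W \<in> carrier_mat n n" by simp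
  have conj: "?W * D = E * ?W \<longleftrightarrow> U * D * mat_adjoint U = V * E * mat_adjoint V"
    if [simp]: "D \<in> carrier_mat n n" "E \<in> carrier_mat n n" for D E
  proof
    assume a: "?W * D = E * ?W"
    have "U * D * mat_adjoint U = (V * mat_adjoint V) * (U * D * mat_adjoint U)"
      by (simp add: unit one)
    also have "\<dots> = V * (?W * D) * mat_adjoint U"
      by (simp add: assoc)
    also have "\<dots> = V * E * mat_adjoint V * (U * mat_adjoint U)"
      unfolding a by (simp add: assoc)
    finally show "U * D * mat_adjoint U = V * E * mat_adjoint V"
      by (simp add: unit one)
  next
    assume a: "U * D * mat_adjoint U = V * E * mat_adjoint V"
    have "?W * D = mat_adjoint V * U * D * (mat_adjoint U * U)"
      by (simp add: unit one)
    also have "\<dots> = mat_adjoint V * (U * D * mat_adjoint U) * U"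
      by (simp add: assoc)
    also have "\<dots> = (mat_adjoint V * V) * E * (mat_adjoint V * U)"
      unfolding a by (simp add: assoc)
    finally show "?W * D = E * ?W" by (simp add: unit one)
  qed
  have left: "(?W * real_diag n c) $$ (i,j) = ?W $$ (i,j) * c j"
    and right: "(real_diag n c * ?W) $$ (i,j) = c i * ?W $$ (i,j)"
    if "i < n" "j < n" for c :: "nat \<Rightarrow> real" and i j
    unfolding real_diag_def mat_diag_mult_left[OF W] mat_diag_mult_right[OF W]
    using that by (simp_all only: index_mat prod.case)
  have "?W * real_diag n d = real_diag n e * ?W" using eq conj by simp
  then have ent: "?W $$ (i,j) * d j = e i * ?W $$ (i,j)" if "i < n" "j < n" for i j
    using left[OF that, of d] right[OF that, of e] by (simp only:)
  have "?W * real_diag n (f \<circ> d) = real_diag n (f \<circ> e) * ?W"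
  proof (rule eq_matI)
    fix i j
    assume "i < dim_row (real_diag n (f \<circ> e) * ?W)" "j < dim_col (real_diag n (f \<circ> e) * ?W)"
    then have ij: "i < n" "j < n" using carrier_matD[OF mult_c[OF real_diag_carrier W]] by (simp_all only:)
    obtain w where w: "?W $$ (i,j) = w" by blast
    have "w * d j = e i * w" using ent[OF ij] unfolding w .
    then have "w = 0 \<or> d j = e i" by auto
    then show "(?W * real_diag n (f \<circ> d)) $$ (i,j) = (real_diag n (f \<circ> e) * ?W) $$ (i,j)"
      unfolding left[OF ij] right[OF ij] w by auto
  qed (simp_all only: carrier_matD[OF mult_c[OF real_diag_carrier W]]
        carrier_matD[OF mult_c[OF W real_diag_carrier]])
  then show ?thesis using conj by simp
qed

lemma fun_calc_unitary_diag:
  assumes U: "unitary_mat n U"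
  shows "fun_calc f (U * real_diag n d * mat_adjoint U)
           = U * real_diag n (f \<circ> d) * mat_adjoint U"
proof -
  have dim: "dim_row (U * X * Y) = n" for X Y
    using U by (auto simp: unitary_mat_def)
  show ?thesis
    unfolding fun_calc_def dim
  proof (rule the_equality)
    fix X
    assume "\<exists>U' e. unitary_mat n U' \<and>
      U * real_diag n d * mat_adjoint U = U' * real_diag n e * mat_adjoint U' \<and>
      X = U' * real_diag n (f \<circ> e) * mat_adjoint U'"
    then obtain U' e where U': "unitary_mat n U'"
      and eq: "U * real_diag n d * mat_adjoint U = U' * real_diag n e * mat_adjoint U'"
      and X: "X = U' * real_diag n (f \<circ> e) * mat_adjoint U'"
      by (elim exE conjE)
    show "X = U * real_diag n (f \<circ> d) * mat_adjoint U"
      unfolding X by (rule fun_calc_unique[OF U U' eq, symmetric])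
  qed (intro exI conjI, rule U, rule refl, rule refl)
qed

end

theory Submission
  imports Defs "Jordan_Normal_Form.Spectral_Radius"
begin

text \<open>Write \<open>P = \<Phi>(AB)\<close>, \<open>T = \<Phi>(A)\<close>, \<open>X = \<Phi>(A)\<Phi>(B)\<close>, and \<open>D = \<Phi>(B/A)\<close>, where \<open>0/0 = 0\<close>.
  Concavity of \<open>h\<close> makes both \<open>A = h(B)\<close> and \<open>B/A\<close> increasing functions of \<open>B\<close>. On the commutative
  algebra generated by \<open>B\<close>, positivity of the scalar matrices with rows \<open>(ab, b)\<close> and
  \<open>(b, b/a)\<close> passes to the block matrix with rows \<open>(P, \<Phi>(B))\<close> and \<open>(\<Phi>(B), D)\<close>, so the block matrix with rows \<open>(P, X*)\<close> and \<open>(X, TDT)\<close> is positive. If \<open>|X| = K*X\<close>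
  with a contraction \<open>K\<close>, then \<open>2|X| \<le> P + K*TDTK\<close>, and it remains to bound the eigenvalues of
  \<open>Z = K*TDTK\<close> by those of \<open>P\<close>, listed in decreasing order.

  Given a level \<open>\<mu> > 0\<close>, the graph of the increasing relation between \<open>B/A\<close> and \<open>A\<^sup>2\<close> has a pivot
  \<open>(\<delta>, \<epsilon>)\<close> with \<open>\<delta>\<epsilon> = \<mu>\<close>, for which \<open>(B/A - \<delta>)(A\<^sup>2 - \<epsilon>) \<ge> 0\<close>. With Kadison's inequality
  this gives \<open>P \<ge> \<epsilon>D + \<delta>T\<^sup>2 - \<mu>\<close>. An arithmetic-geometric mean argument shows that
  \<open>x \<mapsto> (1 + D/\<delta>)TKx\<close> carries vectors on which \<open>Z \<ge> \<mu>\<close> injectively to vectors on which \<open>P \<ge> \<mu>\<close>.\<close>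

subsection \<open>Adjoints and the real inner product\<close>

lemma dim_mat_adjoint [simp]:
  "dim_row (mat_adjoint A) = dim_col A" "dim_col (mat_adjoint A) = dim_row A"
  by (simp_all add: mat_adjoint_def)

lemma index_mat_adjoint [simp]:
  fixes A :: "complex mat"
  assumes "i < dim_col A" "j < dim_row A"
  shows "mat_adjoint A $$ (i, j) = cnj (A $$ (j, i))"
  using assms by (simp add: mat_adjoint_def mat_of_rows_index)

lemma mat_adjoint_adjoint [simp]: "mat_adjoint (mat_adjoint (A :: complex mat)) = A"
  by (rule eq_matI) simp_all

lemma mat_adjoint_mult:
  fixes A B :: "complex mat"
  assumes "A \<in> carrier_mat n m" "B \<in> carrier_mat m k"
  shows "mat_adjoint (A * B) = mat_adjoint B * mat_adjoint A"
  using assms by (intro eq_matI) (auto simp: scalar_prod_def mult.commute intro!: sum.cong)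

lemma square_mat_mult_carrier [simp]:
  "A \<in> carrier_mat n n \<Longrightarrow> B \<in> carrier_mat n n \<Longrightarrow> A * B \<in> carrier_mat n n"
  by simp

lemma square_mat_mult_vec_carrier [simp]:
  "A \<in> carrier_mat n n \<Longrightarrow> x \<in> carrier_vec n \<Longrightarrow> A *\<^sub>v x \<in> carrier_vec n"
  by simp

lemma mat_adjoint_one [simp]: "mat_adjoint (1\<^sub>m n :: complex mat) = 1\<^sub>m n"
  by (rule eq_matI) auto

text \<open>Taking real parts keeps every later estimate inside real arithmetic. For Hermitian forms
  nothing is lost, since their values are real.\<close>

definition rip :: "complex vec \<Rightarrow> complex vec \<Rightarrow> real" where
  "rip x y = Re (x \<bullet>c y)"

lemma rip_sum: "y \<in> carrier_vec n \<Longrightarrow> rip x y = (\<Sum>i<n. Re (x $ i * cnj (y $ i)))"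
  by (simp add: rip_def scalar_prod_def atLeast0LessThan)

lemma rip_comm:
  assumes "x \<in> carrier_vec n" "y \<in> carrier_vec n"
  shows "rip x y = rip y x"
  unfolding rip_sum[OF assms(1)] rip_sum[OF assms(2)]
  by (intro sum.cong) (simp_all add: mult.commute)

lemma rip_add_left:
  assumes "x \<in> carrier_vec n" "y \<in> carrier_vec n" "z \<in> carrier_vec n"
  shows "rip (x + y) z = rip x z + rip y z"
  unfolding rip_sum[OF assms(3)] sum.distrib[symmetric]
  using assms by (intro sum.cong) (auto simp: ring_distribs)

lemma rip_add_right:
  assumes "x \<in> carrier_vec n" "y \<in> carrier_vec n" "z \<in> carrier_vec n"
  shows "rip z (x + y) = rip z x + rip z y"
  using rip_add_left[OF assms] assms by (simp add: rip_comm[of z n])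

lemma rip_smult_left:
  assumes "x \<in> carrier_vec n" "z \<in> carrier_vec n"
  shows "rip (complex_of_real c \<cdot>\<^sub>v x) z = c * rip x z"
  using assms by (simp add: rip_sum[OF assms(2)] sum_distrib_left algebra_simps)

lemma rip_smult_right:
  assumes "x \<in> carrier_vec n" "z \<in> carrier_vec n"
  shows "rip z (complex_of_real c \<cdot>\<^sub>v x) = c * rip z x"
  using rip_smult_left[OF assms] assms by (simp add: rip_comm[of z n])

lemma rip_self: "x \<in> carrier_vec n \<Longrightarrow> rip x x = (\<Sum>i<n. (cmod (x $ i))\<^sup>2)"
  by (simp add: rip_sum cmod_power2 flip: power2_eq_square)

lemma rip_self_nonneg: "x \<in> carrier_vec n \<Longrightarrow> 0 \<le> rip x x"
  by (simp add: rip_self sum_nonneg)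

lemma rip_self_pos: "x \<in> carrier_vec n \<Longrightarrow> x \<noteq> 0\<^sub>v n \<Longrightarrow> 0 < rip x x"
  by (auto simp: rip_self vec_eq_iff intro!: sum_pos2)

lemma rip_adjoint:
  assumes A: "A \<in> carrier_mat n m" and x: "x \<in> carrier_vec m" and y: "y \<in> carrier_vec n"
  shows "rip (A *\<^sub>v x) y = rip x (mat_adjoint A *\<^sub>v y)"
proof -
  have "rip (A *\<^sub>v x) y = Re (\<Sum>i<n. \<Sum>j<m. A $$ (i,j) * x $ j * cnj (y $ i))"
    using assms by (simp add: rip_sum[OF y] scalar_prod_def sum_distrib_right atLeast0LessThan)
  also have "\<dots> = Re (\<Sum>j<m. \<Sum>i<n. A $$ (i,j) * x $ j * cnj (y $ i))"
    by (rule arg_cong[OF sum.swap])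
  also have "\<dots> = (\<Sum>j<m. Re (x $ j * cnj (\<Sum>i<n. cnj (A $$ (i,j)) * y $ i)))"
    by (simp add: sum_distrib_left mult_ac del: times_complex.sel)
  also have "\<dots> = rip x (mat_adjoint A *\<^sub>v y)"
    unfolding rip_sum[OF mult_mat_vec_carrier[OF mat_adjoint_carrier[OF A] y]]
    using assms by (intro sum.cong) (auto simp: scalar_prod_def atLeast0LessThan simp del: times_complex.sel)
  finally show ?thesis .
qed

lemma psd_matD:
  assumes "psd_mat n A"
  shows "A \<in> carrier_mat n n" "mat_adjoint A = A"
    "x \<in> carrier_vec n \<Longrightarrow> 0 \<le> rip (A *\<^sub>v x) x"
  using assms by (auto simp: psd_mat_def hermitian_mat_def rip_def less_eq_complex_def)

text \<open>Conjugating the double sum of the form exchanges its two indices, so Hermitian symmetry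
  already makes the form real. The complex order in \<open>psd_mat\<close> then reduces to the sign
  of the real part.\<close>

lemma psd_matI:
  assumes A: "A \<in> carrier_mat n n" "mat_adjoint A = A"
    and nonneg: "\<And>x. x \<in> carrier_vec n \<Longrightarrow> 0 \<le> rip (A *\<^sub>v x) x"
  shows "psd_mat n A"
proof -
  have "Im ((A *\<^sub>v x) \<bullet>c x) = 0" if x: "x \<in> carrier_vec n" for x
  proof -
    let ?s = "\<Sum>i<n. \<Sum>j<n. A $$ (i,j) * x $ j * cnj (x $ i)"
    have s: "(A *\<^sub>v x) \<bullet>c x = ?s"
      using A x by (simp add: scalar_prod_def sum_distrib_right atLeast0LessThan)
    have "cnj ?s = (\<Sum>i<n. \<Sum>j<n. cnj (A $$ (i,j)) * cnj (x $ j) * x $ i)"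
      by simp
    also have "\<dots> = (\<Sum>j<n. \<Sum>i<n. cnj (A $$ (i,j)) * cnj (x $ j) * x $ i)"
      by (rule sum.swap)
    also have "\<dots> = ?s"
    proof (intro sum.cong refl)
      fix i j assume "i \<in> {..<n}" "j \<in> {..<n}"
      then have "mat_adjoint A $$ (j,i) = cnj (A $$ (i,j))" using A(1) by simp
      then show "cnj (A $$ (i,j)) * cnj (x $ j) * x $ i = A $$ (j,i) * x $ i * cnj (x $ j)"
        unfolding A(2) by simp
    qed
    finally have "Im (cnj ?s) = Im ?s" by (rule arg_cong)
    then show ?thesis unfolding s by (simp only: cnj.sel)
  qed
  then show ?thesis
    using assms by (auto simp: psd_mat_def hermitian_mat_def rip_def less_eq_complex_def)
qed

subsection \<open>Unitary diagonalisation\<close>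

lemma unitary_matI:
  assumes "U \<in> carrier_mat n n" "mat_adjoint U * U = 1\<^sub>m n"
  shows "unitary_mat n U"
  using assms mat_mult_left_right_inverse[of "mat_adjoint U" n U] by (simp add: unitary_mat_def)

lemma unitary_mult:
  assumes U: "unitary_mat n U" and V: "unitary_mat n V"
  shows "unitary_mat n (U * V)"
proof (rule unitary_matI)
  have c: "U \<in> carrier_mat n n" "V \<in> carrier_mat n n"
    "mat_adjoint U \<in> carrier_mat n n" "mat_adjoint V \<in> carrier_mat n n"
    using U V by (simp_all add: unitary_mat_def)
  then show "U * V \<in> carrier_mat n n" by simp
  have "mat_adjoint (U * V) * (U * V) = mat_adjoint V * (mat_adjoint U * U) * V"
    using c by (simp add: mat_adjoint_mult[OF c(1,2)] assoc_mult_mat[of _ n n _ n _ n])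
  then show "mat_adjoint (U * V) * (U * V) = 1\<^sub>m n"
    using U V c by (simp add: unitary_mat_def)
qed

lemma unitary_adjoint: "unitary_mat n U \<Longrightarrow> unitary_mat n (mat_adjoint U)"
  by (simp add: unitary_mat_def)

text \<open>Gram-Schmidt applied to a basis that starts with \<open>v\<close> leaves its first
  vector unchanged. It remains only to normalise.\<close>

lemma unitary_with_first_column:
  fixes v :: "complex vec"
  assumes v: "v \<in> carrier_vec n" "v \<noteq> 0\<^sub>v n"
  shows "\<exists>W c. unitary_mat n W \<and> col W 0 = c \<cdot>\<^sub>v v"
proof -
  interpret cof_vec_space n "TYPE(complex)" .
  define ws where "ws = gram_schmidt n (basis_completion v)"
  note bc = basis_completion[OF v]
  have ws: "set ws \<subseteq> carrier_vec n" "corthogonal ws" "length ws = n"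
    using gram_schmidt_result[OF bc(2) bc(4) bc(5) refl, folded ws_def] bc(6) by auto
  have n: "0 < n" using v by (cases n) auto
  obtain vs where "basis_completion v = v # vs"
    using bc(6,7) n by (cases "basis_completion v") auto
  then have hd: "ws ! 0 = v"
    using gram_schmidt_hd[OF v(1), of vs] ws(3) n
    by (cases ws) (auto simp: ws_def)
  have wc: "ws ! i \<in> carrier_vec n" if "i < n" for i
    using ws that by auto
  \<comment> \<open>Reciprocal norms: \<open>gram_schmidt\<close> returns orthogonal vectors that
    need not have length one.\<close>
  define r where "r i = complex_of_real (1 / sqrt (rip (ws ! i) (ws ! i)))" for i
  define W where "W = mat n n (\<lambda>(i,j). r j * ws ! j $ i)"
  have Wc: "W \<in> carrier_mat n n" by (simp add: W_def)
  have ip: "ws ! i \<bullet>c ws ! j = (if i = j then complex_of_real (rip (ws ! i) (ws ! i)) else 0)"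
    if ij: "i < n" "j < n" for i j
  proof (cases "i = j")
    case True
    have "ws ! i \<bullet>c ws ! i \<ge> 0" using conjugate_square_ge_0_vec[of "ws ! i"] .
    then show ?thesis using True by (auto simp: rip_def less_eq_complex_def complex_eq_iff)
  next
    case False
    then show ?thesis using corthogonalD[OF ws(2), of i j] ws(3) ij by simp
  qed
  have pos: "0 < rip (ws ! i) (ws ! i)" if i: "i < n" for i
  proof (rule rip_self_pos[OF wc[OF i]])
    show "ws ! i \<noteq> 0\<^sub>v n"
      using corthogonalD[OF ws(2), of i i] ws(3) i wc[OF i] by auto
  qed
  have "mat_adjoint W * W = 1\<^sub>m n"
  proof (rule eq_matI)
    fix i j assume ij: "i < dim_row (1\<^sub>m n :: complex mat)" "j < dim_col (1\<^sub>m n :: complex mat)"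
    then have ij: "i < n" "j < n" by auto
    have "(mat_adjoint W * W) $$ (i,j) = (\<Sum>k<n. cnj (W $$ (k,i)) * W $$ (k,j))"
      using ij Wc by (auto simp: scalar_prod_def atLeast0LessThan intro!: sum.cong)
    also have "\<dots> = (\<Sum>k<n. cnj (r i) * r j * (ws ! j $ k * cnj (ws ! i $ k)))"
      using ij by (intro sum.cong) (auto simp: W_def)
    also have "\<dots> = cnj (r i) * r j * (ws ! j \<bullet>c ws ! i)"
      using wc[OF ij(1)] by (simp add: scalar_prod_def atLeast0LessThan flip: sum_distrib_left)
    also have "\<dots> = 1\<^sub>m n $$ (i,j)"
    proof (cases "i = j")
      case True
      have "cnj (r i) * r i = complex_of_real (1 / rip (ws ! i) (ws ! i))"
        using pos[OF ij(1)] unfolding r_def complex_cnj_complex_of_real of_real_mult[symmetric] by simp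
      then show ?thesis using True ij pos[OF ij(1)] by (simp add: ip)
    qed (use ij in \<open>simp add: ip\<close>)
    finally show "(mat_adjoint W * W) $$ (i,j) = 1\<^sub>m n $$ (i,j)" .
  qed (use Wc in auto)
  then have "unitary_mat n W" using Wc by (rule unitary_matI[rotated])
  moreover have "col W 0 = r 0 \<cdot>\<^sub>v v"
    using n v(1) by (intro eq_vecI) (auto simp: W_def hd)
  ultimately show ?thesis by blast
qed

text \<open>Deflation: completing an eigenvector to a unitary splits off a 1 by 1 block, and the
  induction hypothesis diagonalises what remains.\<close>

lemma hermitian_mat_diagonalisable:
  assumes "hermitian_mat n A"
  shows "\<exists>U d. unitary_mat n U \<and> A = U * real_diag n d * mat_adjoint U"
  using assms
proof (induction n arbitrary: A)
  case 0
  then have "unitary_mat 0 (1\<^sub>m 0)" "A = 1\<^sub>m 0 * real_diag 0 (\<lambda>_. 0) * mat_adjoint (1\<^sub>m 0)"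
    by (auto simp: hermitian_mat_def intro!: unitary_matI eq_matI)
  then show ?case by blast
next
  case (Suc n)
  let ?N = "Suc n"
  have A: "A \<in> carrier_mat ?N ?N" "mat_adjoint A = A"
    using Suc.prems by (auto simp: hermitian_mat_def)
  obtain e v where ev: "eigenvector A v e"
    using spectrum_non_empty[OF A(1)] by (auto simp: spectrum_def eigenvalue_def)
  then have v: "v \<in> carrier_vec ?N" "v \<noteq> 0\<^sub>v ?N" "A *\<^sub>v v = e \<cdot>\<^sub>v v"
    using A by (auto simp: eigenvector_def)
  obtain W c where W: "unitary_mat ?N W" and W0: "col W 0 = c \<cdot>\<^sub>v v"
    using unitary_with_first_column[OF v(1,2)] by blast
  have Wc: "W \<in> carrier_mat ?N ?N" "mat_adjoint W \<in> carrier_mat ?N ?N"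
    using W by (auto simp: unitary_mat_def)
  define M where "M = mat_adjoint W * A * W"
  have Mc: "M \<in> carrier_mat ?N ?N" using Wc A by (simp add: M_def)
  have Mh: "mat_adjoint M = M"
    using Wc A by (simp add: M_def mat_adjoint_mult[of _ ?N ?N _ ?N] assoc_mult_mat[of _ ?N ?N _ ?N _ ?N])
  have W0c: "col W 0 \<in> carrier_vec ?N" using Wc v(1) by (simp add: W0)
  have "A *\<^sub>v col W 0 = e \<cdot>\<^sub>v col W 0"
    using A v by (simp add: W0 mult_mat_vec[OF A(1) v(1)] smult_smult_assoc mult.commute)
  have "col M 0 = mat_adjoint W *\<^sub>v (A *\<^sub>v col W 0)"
    unfolding M_def using Wc A W0c
    by (subst col_mult2[of _ ?N ?N _ ?N]) (auto simp: assoc_mult_mat_vec[of _ ?N ?N _ ?N])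
  also have "\<dots> = e \<cdot>\<^sub>v col (mat_adjoint W * W) 0"
    using Wc \<open>A *\<^sub>v col W 0 = e \<cdot>\<^sub>v col W 0\<close> mult_mat_vec[OF Wc(2), of "col W 0" e]
    by (subst col_mult2[of _ ?N ?N _ ?N]) auto
  also have "\<dots> = e \<cdot>\<^sub>v unit_vec ?N 0"
    using W by (simp add: unitary_mat_def)
  finally have col0: "M $$ (i,0) = (if i = 0 then e else 0)" if "i < ?N" for i
    using that Mc by (auto simp: vec_eq_iff)
  \<comment> \<open>Hermitian symmetry carries the zeros of the first column over to the first row
    and forces \<open>e\<close> to be real.\<close>
  have sym: "M $$ (i,j) = cnj (M $$ (j,i))" if "i < ?N" "j < ?N" for i j
    using that Mc by (metis Mh carrier_matD index_mat_adjoint)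
  have row0: "M $$ (0,i) = (if i = 0 then e else 0)" if "i < ?N" for i
    using sym[of 0 i] col0[of i] sym[of 0 0] col0[of 0] that by auto
  have e: "e = complex_of_real (Re e)"
    using sym[of 0 0] col0[of 0] by (auto simp: complex_eq_iff)
  define M3 where "M3 = mat n n (\<lambda>(i,j). M $$ (Suc i, Suc j))"
  have "hermitian_mat n M3"
    by (auto simp: hermitian_mat_def M3_def sym[symmetric] intro!: eq_matI)
  then obtain U d where U: "unitary_mat n U" and M3: "M3 = U * real_diag n d * mat_adjoint U"
    using Suc.IH by blast
  have Uc: "U \<in> carrier_mat n n" "mat_adjoint U \<in> carrier_mat n n"
    using U by (auto simp: unitary_mat_def)
  define d' where "d' i = (case i of 0 \<Rightarrow> Re e | Suc j \<Rightarrow> d j)" for i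
  \<comment> \<open>Block-diagonal matrices with a scalar corner are closed under products and
    adjoints, so the diagonalisation of \<open>M3\<close> lifts to \<open>M\<close> block by
    block.\<close>
  let ?blk = "\<lambda>x X. four_block_mat (mat 1 1 (\<lambda>_. x)) (0\<^sub>m 1 n) (0\<^sub>m n 1) X"
  have blk_mult: "?blk x X * ?blk y Y = ?blk (x * y) (X * Y)"
    if "X \<in> carrier_mat n n" "Y \<in> carrier_mat n n" for x y :: complex and X Y
  proof -
    have "mat 1 1 (\<lambda>_. x) * mat 1 1 (\<lambda>_. y) = mat 1 1 (\<lambda>_. x * y)"
      by (rule eq_matI) (auto simp: scalar_prod_def)
    then show ?thesis
      using that by (subst mult_four_block_mat[of _ 1 1 _ n _ n _ _ 1 _ n]) auto
  qed
  have blk_adj: "mat_adjoint (?blk x X) = ?blk (cnj x) (mat_adjoint X)"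
    if "X \<in> carrier_mat n n" for x X
    using that by (intro eq_matI) auto
  have blk_diag: "real_diag ?N d' = ?blk e (real_diag n d)"
    using e by (intro eq_matI) (auto simp: real_diag_def mat_diag_def d'_def split: nat.split)
  have blk_one: "1\<^sub>m ?N = ?blk 1 (1\<^sub>m n)"
    by (intro eq_matI) auto
  have "M = ?blk e M3"
  proof (rule eq_matI)
    fix i j assume "i < dim_row (?blk e M3)" "j < dim_col (?blk e M3)"
    then have "i < ?N" "j < ?N" by (auto simp: M3_def)
    then show "M $$ (i,j) = ?blk e M3 $$ (i,j)"
      by (cases i; cases j) (auto simp: col0 row0 M3_def)
  qed (use Mc in \<open>auto simp: M3_def\<close>)
  define V where "V = ?blk 1 U"
  have "V \<in> carrier_mat (1 + n) (1 + n)"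
    unfolding V_def by (rule four_block_carrier_mat[OF _ Uc(1)]) simp
  then have Vc: "V \<in> carrier_mat ?N ?N" "mat_adjoint V \<in> carrier_mat ?N ?N"
    by simp_all
  have V: "unitary_mat ?N V"
  proof (rule unitary_matI[OF Vc(1)])
    show "mat_adjoint V * V = 1\<^sub>m ?N"
      using U Uc unfolding V_def blk_adj[OF Uc(1)] blk_mult[OF Uc(2,1)] blk_one
      by (simp add: unitary_mat_def)
  qed
  have "V * real_diag ?N d' * mat_adjoint V = M"
    unfolding \<open>M = ?blk e M3\<close> M3 V_def blk_diag blk_adj[OF Uc(1)]
      blk_mult[OF Uc(1) real_diag_carrier]
      blk_mult[OF square_mat_mult_carrier[OF Uc(1) real_diag_carrier] Uc(2)]
    by simp
  then have "W * (V * real_diag ?N d' * mat_adjoint V) * mat_adjoint W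
      = W * (mat_adjoint W * A * W) * mat_adjoint W"
    by (simp only: M_def)
  then have "W * V * real_diag ?N d' * mat_adjoint (W * V) = W * mat_adjoint W * A * (W * mat_adjoint W)"
    using Wc Vc A
    by (simp add: mat_adjoint_mult[of _ ?N ?N _ ?N] assoc_mult_mat[of _ ?N ?N _ ?N _ ?N])
  also have "\<dots> = A" using W A by (simp add: unitary_mat_def)
  finally show ?case
    using unitary_mult[OF W V] by (intro exI[of _ "W * V"] exI[of _ d']) simp
qed

lemma unitary_diag_index:
  assumes "U \<in> carrier_mat n n" "i < n" "j < n"
  shows "(U * real_diag n d * mat_adjoint U) $$ (i,j)
           = (\<Sum>k<n. complex_of_real (d k) * (U $$ (i,k) * cnj (U $$ (j,k))))"
proof -
  have "U * real_diag n d = mat n n (\<lambda>(i,j). U $$ (i,j) * complex_of_real (d j))"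
    using assms(1) unfolding real_diag_def by (subst mat_diag_mult_right) auto
  then show ?thesis
    using assms by (auto simp: scalar_prod_def atLeast0LessThan intro!: sum.cong)
qed

lemma decreasing_rearrangement:
  fixes d :: "nat \<Rightarrow> real"
  shows "\<exists>p. p permutes {..<n} \<and> (\<forall>i j. i \<le> j \<longrightarrow> j < n \<longrightarrow> d (p j) \<le> d (p i))"
proof -
  let ?xs = "map d [0..<n]" and ?ys = "rev (sort (map d [0..<n]))"
  have "mset ?ys = mset ?xs" by simp
  then obtain p where p: "p permutes {..<length ?xs}" "permute_list p ?xs = ?ys"
    by (rule mset_eq_permutation)
  have "d (p i) = ?ys ! i" if "i < n" for i
    using permute_list_nth[OF p(1), of i] permutes_in_image[OF p(1), of i] that
    by (simp add: p(2))
  moreover have "?ys ! j \<le> ?ys ! i" if "i \<le> j" "j < n" for i j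
    using that by (auto simp: rev_nth intro!: sorted_nth_mono)
  ultimately show ?thesis using p(1) by (intro exI[of _ p]) auto
qed

theorem hermitian_mat_spectral:
  assumes A: "hermitian_mat n A"
  shows "\<exists>U d. unitary_mat n U \<and> A = U * real_diag n d * mat_adjoint U
           \<and> (\<forall>i j. i \<le> j \<longrightarrow> j < n \<longrightarrow> d j \<le> d i)"
proof -
  obtain U d where U: "unitary_mat n U" and Ad: "A = U * real_diag n d * mat_adjoint U"
    using hermitian_mat_diagonalisable[OF A] by blast
  obtain p where p: "p permutes {..<n}" and dec: "\<forall>i j. i \<le> j \<longrightarrow> j < n \<longrightarrow> d (p j) \<le> d (p i)"
    using decreasing_rearrangement[of n d] by auto
  have Uc: "U \<in> carrier_mat n n" using U by (simp add: unitary_mat_def)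
  \<comment> \<open>Permuting the columns of \<open>U\<close> along with the eigenvalues only
    reindexes the sum in \<open>unitary_diag_index\<close>.\<close>
  define V where "V = mat n n (\<lambda>(i,j). U $$ (i, p j))"
  have Vc: "V \<in> carrier_mat n n" by (simp add: V_def)
  have perm: "V * real_diag n (f \<circ> p) * mat_adjoint V = U * real_diag n f * mat_adjoint U" for f
  proof (rule eq_matI)
    fix i j assume "i < dim_row (U * real_diag n f * mat_adjoint U)" "j < dim_col (U * real_diag n f * mat_adjoint U)"
    then have ij: "i < n" "j < n" using Uc by auto
    have "(\<Sum>k<n. complex_of_real (f k) * (U $$ (i,k) * cnj (U $$ (j,k))))
        = (\<Sum>k<n. complex_of_real (f (p k)) * (U $$ (i,p k) * cnj (U $$ (j,p k))))"
      by (rule sum.reindex_bij_betw[OF permutes_imp_bij[OF p], symmetric])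
    then show "(V * real_diag n (f \<circ> p) * mat_adjoint V) $$ (i,j) = (U * real_diag n f * mat_adjoint U) $$ (i,j)"
      unfolding unitary_diag_index[OF Uc ij] unitary_diag_index[OF Vc ij]
      using ij by (simp add: V_def)
  qed (use Uc Vc in auto)
  have one: "real_diag n (\<lambda>_. 1) = 1\<^sub>m n"
    by (rule eq_matI) (auto simp: real_diag_def mat_diag_def)
  \<comment> \<open>The reindexing identity at the constant function 1 also shows that
    \<open>V\<close> is unitary. It controls \<open>V\<close> times its adjoint, hence the detour
    through \<open>mat_adjoint V\<close>.\<close>
  have "V * mat_adjoint V = U * mat_adjoint U"
    using perm[of "\<lambda>_. 1"] Uc Vc by (simp add: o_def one)
  then have "unitary_mat n (mat_adjoint V)"
    using U Vc by (intro unitary_matI) (auto simp: unitary_mat_def)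
  then have "unitary_mat n V" using unitary_adjoint by fastforce
  then show ?thesis using perm[of d] Ad dec by (intro exI[of _ V] exI[of _ "d \<circ> p"]) auto
qed

subsection \<open>Matrices diagonal in a fixed unitary basis\<close>

text \<open>With \<open>U\<close> fixed, this embeds real functions on the indices below
  \<open>n\<close> as a commutative algebra of Hermitian matrices, where the functional calculus
  acts pointwise.\<close>

definition spec_mat :: "nat \<Rightarrow> complex mat \<Rightarrow> (nat \<Rightarrow> real) \<Rightarrow> complex mat" where
  "spec_mat n U d = U * real_diag n d * mat_adjoint U"

lemma spec_mat_carrier [simp]: "U \<in> carrier_mat n n \<Longrightarrow> spec_mat n U d \<in> carrier_mat n n"
  by (simp add: spec_mat_def)

lemma spec_mat_index:
  assumes "U \<in> carrier_mat n n" "i < n" "j < n"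
  shows "spec_mat n U d $$ (i,j) = (\<Sum>k<n. complex_of_real (d k) * (U $$ (i,k) * cnj (U $$ (j,k))))"
  unfolding spec_mat_def by (rule unitary_diag_index[OF assms])

lemma mat_adjoint_spec_mat:
  assumes U: "U \<in> carrier_mat n n"
  shows "mat_adjoint (spec_mat n U d) = spec_mat n U d"
  using carrier_matD[OF spec_mat_carrier[OF U, of d]]
  by (intro eq_matI) (auto simp: spec_mat_index[OF U] mult.commute intro!: sum.cong)

lemma spec_mat_add:
  assumes U: "U \<in> carrier_mat n n"
  shows "spec_mat n U (\<lambda>i. d i + e i) = spec_mat n U d + spec_mat n U e"
  using carrier_matD[OF spec_mat_carrier[OF U]]
  by (intro eq_matI) (auto simp: spec_mat_index[OF U] ring_distribs sum.distrib)

lemma spec_mat_smult: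
  assumes U: "U \<in> carrier_mat n n"
  shows "spec_mat n U (\<lambda>i. c * d i) = complex_of_real c \<cdot>\<^sub>m spec_mat n U d"
  using carrier_matD[OF spec_mat_carrier[OF U]]
  by (intro eq_matI) (auto simp: spec_mat_index[OF U] sum_distrib_left mult.assoc)

lemma spec_mat_cong:
  assumes U: "U \<in> carrier_mat n n" and "\<And>i. i < n \<Longrightarrow> d i = e i"
  shows "spec_mat n U d = spec_mat n U e"
  using carrier_matD[OF spec_mat_carrier[OF U]] assms(2)
  by (intro eq_matI) (auto simp: spec_mat_index[OF U] intro!: sum.cong)

lemma real_diag_one: "real_diag n (\<lambda>_. 1) = 1\<^sub>m n"
  by (rule eq_matI) (auto simp: real_diag_def mat_diag_def)

lemma spec_mat_one: "unitary_mat n U \<Longrightarrow> spec_mat n U (\<lambda>_. 1) = 1\<^sub>m n"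
  by (auto simp: spec_mat_def unitary_mat_def real_diag_one right_mult_one_mat[of _ n n])

lemma spec_mat_mult:
  assumes U: "unitary_mat n U"
  shows "spec_mat n U d * spec_mat n U e = spec_mat n U (\<lambda>i. d i * e i)"
proof -
  have c: "U \<in> carrier_mat n n" "mat_adjoint U \<in> carrier_mat n n"
    using U by (auto simp: unitary_mat_def)
  have "spec_mat n U d * spec_mat n U e
      = U * real_diag n d * (mat_adjoint U * U) * real_diag n e * mat_adjoint U"
    using c by (simp add: spec_mat_def assoc_mult_mat[of _ n n _ n _ n])
  also have "\<dots> = U * (real_diag n d * real_diag n e) * mat_adjoint U"
    using U c
    by (simp add: unitary_mat_def assoc_mult_mat[of _ n n _ n _ n] left_mult_one_mat[of _ n n])
  also have "real_diag n d * real_diag n e = real_diag n (\<lambda>i. d i * e i)"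
    by (simp add: real_diag_def)
  finally show ?thesis by (simp add: spec_mat_def)
qed

lemma fun_calc_spec_mat:
  assumes "unitary_mat n U"
  shows "fun_calc f (spec_mat n U d) = spec_mat n U (\<lambda>i. f (d i))"
  using fun_calc_unitary_diag[OF assms, of f d] by (simp add: spec_mat_def o_def)

lemma real_diag_mult_vec:
  assumes y: "y \<in> carrier_vec n"
  shows "real_diag n d *\<^sub>v y = vec n (\<lambda>i. complex_of_real (d i) * y $ i)"
proof (rule eq_vecI)
  fix i assume "i < dim_vec (vec n (\<lambda>i. complex_of_real (d i) * y $ i))"
  then have i: "i < n" by simp
  have "(real_diag n d *\<^sub>v y) $ i = (\<Sum>k<n. (if i = k then complex_of_real (d k) else 0) * y $ k)"
    using i y by (simp add: scalar_prod_def atLeast0LessThan real_diag_def mat_diag_def)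
  also have "\<dots> = (\<Sum>k<n. if k = i then complex_of_real (d i) * y $ i else 0)"
    by (intro sum.cong) auto
  finally show "(real_diag n d *\<^sub>v y) $ i = vec n (\<lambda>i. complex_of_real (d i) * y $ i) $ i"
    using i by simp
qed (simp add: real_diag_def mat_diag_def)

lemma rip_spec_mat:
  assumes U: "U \<in> carrier_mat n n" and x: "x \<in> carrier_vec n"
  shows "rip (spec_mat n U d *\<^sub>v x) x = (\<Sum>i<n. d i * (cmod ((mat_adjoint U *\<^sub>v x) $ i))\<^sup>2)"
proof -
  let ?y = "mat_adjoint U *\<^sub>v x"
  have U': "mat_adjoint U \<in> carrier_mat n n" using U by simp
  have y: "?y \<in> carrier_vec n" using U' x by (rule mult_mat_vec_carrier)
  note Dy = real_diag_mult_vec[OF y, of d]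
  have "spec_mat n U d *\<^sub>v x = U *\<^sub>v (real_diag n d *\<^sub>v ?y)"
    using U U' x y unfolding spec_mat_def by (simp add: assoc_mult_mat_vec[of _ n n _ n])
  then have "rip (spec_mat n U d *\<^sub>v x) x = rip (real_diag n d *\<^sub>v ?y) ?y"
    using rip_adjoint[OF U _ x, of "real_diag n d *\<^sub>v ?y"] Dy by simp
  also have "\<dots> = (\<Sum>i<n. d i * (cmod (?y $ i))\<^sup>2)"
    unfolding rip_sum[OF y] Dy
    by (intro sum.cong) (simp_all add: cmod_power2 algebra_simps flip: power2_eq_square)
  finally show ?thesis .
qed

lemma rip_self_unitary:
  assumes U: "unitary_mat n U" and x: "x \<in> carrier_vec n"
  shows "rip x x = (\<Sum>i<n. (cmod ((mat_adjoint U *\<^sub>v x) $ i))\<^sup>2)"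
proof -
  have "U \<in> carrier_mat n n" using U by (simp add: unitary_mat_def)
  from rip_spec_mat[OF this x, of "\<lambda>_. 1"] show ?thesis
    unfolding spec_mat_one[OF U] one_mult_mat_vec[OF x] by (simp only: mult_1)
qed

lemma psd_spec_mat:
  assumes U: "U \<in> carrier_mat n n" and d: "\<And>i. i < n \<Longrightarrow> 0 \<le> d i"
  shows "psd_mat n (spec_mat n U d)"
  using d by (intro psd_matI) (auto simp: U mat_adjoint_spec_mat rip_spec_mat intro!: sum_nonneg)

text \<open>Testing the form at the \<open>i\<close>-th column of \<open>U\<close> isolates
  \<open>d i\<close>.\<close>

lemma psd_spec_matD:
  assumes U: "unitary_mat n U" and psd: "psd_mat n (spec_mat n U d)" and i: "i < n"
  shows "0 \<le> d i"
proof -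
  have c: "U \<in> carrier_mat n n" "mat_adjoint U \<in> carrier_mat n n" "mat_adjoint U * U = 1\<^sub>m n"
    using U by (auto simp: unitary_mat_def)
  let ?x = "U *\<^sub>v unit_vec n i"
  have x: "?x \<in> carrier_vec n" using c by simp
  have "mat_adjoint U *\<^sub>v ?x = unit_vec n i"
    using c by (simp flip: assoc_mult_mat_vec[of _ n n _ n])
  then have "rip (spec_mat n U d *\<^sub>v ?x) ?x = (\<Sum>k<n. d k * (cmod (unit_vec n i $ k))\<^sup>2)"
    by (simp only: rip_spec_mat[OF c(1) x])
  also have "\<dots> = (\<Sum>k<n. if k = i then d i else 0)"
    using i by (intro sum.cong) auto
  finally have "rip (spec_mat n U d *\<^sub>v ?x) ?x = (\<Sum>k<n. if k = i then d i else 0)" .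
  then show ?thesis using psd_matD(3)[OF psd x] i by simp
qed

lemma psd_spectral:
  assumes "psd_mat n A"
  shows "\<exists>U d. unitary_mat n U \<and> A = spec_mat n U d \<and> (\<forall>i<n. 0 \<le> d i)
           \<and> (\<forall>i j. i \<le> j \<longrightarrow> j < n \<longrightarrow> d j \<le> d i)"
proof -
  obtain U d where "unitary_mat n U" "A = spec_mat n U d" "\<forall>i j. i \<le> j \<longrightarrow> j < n \<longrightarrow> d j \<le> d i"
    using hermitian_mat_spectral[of n A] assms by (auto simp: psd_mat_def spec_mat_def)
  then show ?thesis using psd_spec_matD[of n U d] assms by (intro exI[of _ U] exI[of _ d]) auto
qed

subsection \<open>Eigenvalue comparison\<close>

text \<open>These are \<open>j\<close> homogeneous equations in the \<open>j + 1\<close> unknowns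
  with index at most \<open>j\<close>. They are padded to a square system so that the determinant
  criterion applies.\<close>

lemma underdetermined_system:
  fixes K :: "complex mat"
  assumes K: "K \<in> carrier_mat n n" and j: "j < n"
  shows "\<exists>c \<in> carrier_vec n. c \<noteq> 0\<^sub>v n \<and> (\<forall>i. j < i \<longrightarrow> i < n \<longrightarrow> c $ i = 0)
           \<and> (\<forall>i<j. (K *\<^sub>v c) $ i = 0)"
proof -
  \<comment> \<open>The rows are the \<open>j\<close> equations, then one zero row that makes
    \<open>L\<close> singular, then unit rows that force the later coordinates of \<open>c\<close>
    to vanish.\<close>
  define L where "L = mat n n (\<lambda>(i,k). if i < j then K $$ (i,k) else if i = j then 0
    else if k = i then 1 else 0)"
  have L: "L \<in> carrier_mat n n" by (simp add: L_def)
  have "transpose_mat L *\<^sub>v unit_vec n j = 0\<^sub>v n"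
    using j by (intro eq_vecI) (auto simp: L_def)
  then have "det (transpose_mat L) = 0"
    using j L by (subst det_0_iff_vec_prod_zero[of _ n]) (auto intro!: exI[of _ "unit_vec n j"])
  then obtain c where c: "c \<in> carrier_vec n" "c \<noteq> 0\<^sub>v n" "L *\<^sub>v c = 0\<^sub>v n"
    using det_0_iff_vec_prod_zero[OF L] by (auto simp: det_transpose[OF L])
  have row: "(\<Sum>k<n. L $$ (i,k) * c $ k) = 0" if i: "i < n" for i
  proof -
    have "(L *\<^sub>v c) $ i = 0" using c(3) i by simp
    then show ?thesis using L c(1) i by (simp add: scalar_prod_def atLeast0LessThan)
  qed
  have "c $ i = 0" if i: "j < i" "i < n" for i
  proof -
    have "(\<Sum>k<n. L $$ (i,k) * c $ k) = (\<Sum>k<n. if k = i then c $ i else 0)"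
      using i by (intro sum.cong) (auto simp: L_def)
    then show ?thesis using row[of i] i by simp
  qed
  moreover have "(K *\<^sub>v c) $ i = 0" if i: "i < j" for i
  proof -
    have "(K *\<^sub>v c) $ i = (\<Sum>k<n. L $$ (i,k) * c $ k)"
      using i j K c(1) by (auto simp: L_def scalar_prod_def atLeast0LessThan intro!: sum.cong)
    then show ?thesis using row[of i] i j by simp
  qed
  ultimately show ?thesis using c by blast
qed

text \<open>The hypothesis compares, for every level \<open>\<mu>\<close>, the dimensions of the spaces on which the two
  forms are at least \<open>\<mu>\<close>; by the minimax principle this orders the decreasingly listed eigenvalues.\<close>

lemma unitary_orbit_dominates:
  assumes Z: "hermitian_mat n Z" and P: "psd_mat n P"
    and dom: "\<And>\<mu>. 0 < \<mu> \<Longrightarrow> \<exists>N \<in> carrier_mat n n. \<forall>x \<in> carrier_vec n.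
      x \<noteq> 0\<^sub>v n \<longrightarrow> \<mu> * rip x x \<le> rip (Z *\<^sub>v x) x \<longrightarrow>
      N *\<^sub>v x \<noteq> 0\<^sub>v n \<and> \<mu> * rip (N *\<^sub>v x) (N *\<^sub>v x) \<le> rip (P *\<^sub>v (N *\<^sub>v x)) (N *\<^sub>v x)"
  shows "\<exists>V. unitary_mat n V \<and>
    (\<forall>x \<in> carrier_vec n. rip (Z *\<^sub>v x) x \<le> rip ((V * P * mat_adjoint V) *\<^sub>v x) x)"
proof -
  obtain U z where U: "unitary_mat n U" and Zd: "Z = spec_mat n U z"
    and z: "\<And>i j. i \<le> j \<Longrightarrow> j < n \<Longrightarrow> z j \<le> z i"
    using hermitian_mat_spectral[OF Z] unfolding spec_mat_def by blast
  obtain W p where W: "unitary_mat n W" and Pd: "P = spec_mat n W p"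
    and p0: "\<And>i. i < n \<Longrightarrow> 0 \<le> p i" and p: "\<And>i j. i \<le> j \<Longrightarrow> j < n \<Longrightarrow> p j \<le> p i"
    using psd_spectral[OF P] by auto
  have c: "U \<in> carrier_mat n n" "mat_adjoint U \<in> carrier_mat n n"
    "W \<in> carrier_mat n n" "mat_adjoint W \<in> carrier_mat n n"
    using U W by (auto simp: unitary_mat_def)
  have zp: "z j \<le> p j" if j: "j < n" for j
  proof (rule ccontr)
    assume "\<not> z j \<le> p j"
    then have less: "p j < z j" and pos: "0 < z j" using p0[OF j] by auto
    obtain N where N: "N \<in> carrier_mat n n"
      and *: "\<And>x. x \<in> carrier_vec n \<Longrightarrow> x \<noteq> 0\<^sub>v n \<Longrightarrow> z j * rip x x \<le> rip (Z *\<^sub>v x) x \<Longrightarrow>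
      N *\<^sub>v x \<noteq> 0\<^sub>v n \<and> z j * rip (N *\<^sub>v x) (N *\<^sub>v x) \<le> rip (P *\<^sub>v (N *\<^sub>v x)) (N *\<^sub>v x)"
      using dom[OF pos] by blast
    \<comment> \<open>Dimension count: \<open>U b\<close> lies in the span of the first
      \<open>j + 1\<close> eigenvectors of \<open>Z\<close>, where the form is at least
      \<open>z j\<close>, and its image under \<open>N\<close> is orthogonal to the first
      \<open>j\<close> eigenvectors of \<open>P\<close>, where the form is at most
      \<open>p j\<close>.\<close>
    obtain b where b: "b \<in> carrier_vec n" "b \<noteq> 0\<^sub>v n"
      and b1: "\<And>i. j < i \<Longrightarrow> i < n \<Longrightarrow> b $ i = 0"
      and b2: "\<And>i. i < j \<Longrightarrow> ((mat_adjoint W * N * U) *\<^sub>v b) $ i = 0"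
      using underdetermined_system[of "mat_adjoint W * N * U" n j] c N j by auto
    define x where "x = U *\<^sub>v b"
    have x: "x \<in> carrier_vec n" using b c by (simp add: x_def)
    have Ux: "mat_adjoint U *\<^sub>v x = b"
      using b c U by (simp add: x_def unitary_mat_def flip: assoc_mult_mat_vec[of _ n n _ n])
    have x0: "x \<noteq> 0\<^sub>v n"
    proof
      assume "x = 0\<^sub>v n"
      then have "mat_adjoint U *\<^sub>v x = 0\<^sub>v n" using c(2) by (intro eq_vecI) (auto simp: scalar_prod_def)
      then show False using Ux b(2) by simp
    qed
    have "z j * rip x x = (\<Sum>i<n. z j * (cmod (b $ i))\<^sup>2)"
      by (simp add: rip_self_unitary[OF U x] Ux sum_distrib_left)
    also have "\<dots> \<le> (\<Sum>i<n. z i * (cmod (b $ i))\<^sup>2)"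
    proof (rule sum_mono)
      fix i assume "i \<in> {..<n}"
      then show "z j * (cmod (b $ i))\<^sup>2 \<le> z i * (cmod (b $ i))\<^sup>2"
        using z[of i j] b1[of i] j by (cases "i \<le> j") (auto intro: mult_right_mono)
    qed
    also have "\<dots> = rip (Z *\<^sub>v x) x"
      by (simp add: Zd rip_spec_mat[OF c(1) x] Ux)
    finally have Nx0: "N *\<^sub>v x \<noteq> 0\<^sub>v n"
      and Nx: "z j * rip (N *\<^sub>v x) (N *\<^sub>v x) \<le> rip (P *\<^sub>v (N *\<^sub>v x)) (N *\<^sub>v x)"
      using *[OF x x0] by auto
    define w where "w = N *\<^sub>v x"
    have w: "w \<in> carrier_vec n" using N x by (simp add: w_def)
    have "mat_adjoint W *\<^sub>v w = (mat_adjoint W * N * U) *\<^sub>v b"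
      using c N b by (simp add: w_def x_def assoc_mult_mat_vec[of _ n n _ n])
    then have w2: "(mat_adjoint W *\<^sub>v w) $ i = 0" if "i < j" for i using b2[OF that] by simp
    have "rip (P *\<^sub>v w) w = (\<Sum>i<n. p i * (cmod ((mat_adjoint W *\<^sub>v w) $ i))\<^sup>2)"
      by (simp add: Pd rip_spec_mat[OF c(3) w])
    also have "\<dots> \<le> (\<Sum>i<n. p j * (cmod ((mat_adjoint W *\<^sub>v w) $ i))\<^sup>2)"
    proof (rule sum_mono)
      fix i assume "i \<in> {..<n}"
      then show "p i * (cmod ((mat_adjoint W *\<^sub>v w) $ i))\<^sup>2 \<le> p j * (cmod ((mat_adjoint W *\<^sub>v w) $ i))\<^sup>2"
        using p[of j i] w2[of i] by (cases "j \<le> i") (auto intro: mult_right_mono)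
    qed
    also have "\<dots> = p j * rip w w"
      by (simp add: rip_self_unitary[OF W w] sum_distrib_left)
    also have "\<dots> < z j * rip w w"
      using less rip_self_pos[OF w] Nx0 by (simp add: w_def)
    finally show False using Nx by (simp add: w_def)
  qed
  \<comment> \<open>\<open>V\<close> carries the eigenbasis of \<open>P\<close> to that of
    \<open>Z\<close>, so both forms become diagonal together and \<open>zp\<close> compares them
    term by term.\<close>
  define V where "V = U * mat_adjoint W"
  have V: "unitary_mat n V" unfolding V_def by (intro unitary_mult U unitary_adjoint W)
  have "V * P * mat_adjoint V = U * (mat_adjoint W * W) * real_diag n p * (mat_adjoint W * W) * mat_adjoint U"
    using c by (simp add: V_def Pd spec_mat_def mat_adjoint_mult[of _ n n _ n] assoc_mult_mat[of _ n n _ n _ n])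
  also have "\<dots> = spec_mat n U p"
    using W c by (simp add: spec_mat_def unitary_mat_def right_mult_one_mat[of _ n n])
  finally have "V * P * mat_adjoint V = spec_mat n U p" .
  then have "rip (Z *\<^sub>v x) x \<le> rip ((V * P * mat_adjoint V) *\<^sub>v x) x" if "x \<in> carrier_vec n" for x
    using zp that by (auto simp: Zd rip_spec_mat[OF c(1)] intro!: sum_mono mult_right_mono)
  then show ?thesis using V by blast
qed

subsection \<open>The absolute value\<close>

text \<open>The factor is the partial isometry of the polar decomposition, obtained as
  \<open>X\<close> times a pseudo-inverse of \<open>abs_mat X\<close>.\<close>

lemma abs_mat_contraction:
  assumes X: "X \<in> carrier_mat n n"
  shows "\<exists>U \<in> carrier_mat n n. mat_adjoint U * X = abs_mat X
           \<and> (\<forall>x \<in> carrier_vec n. rip (U *\<^sub>v x) (U *\<^sub>v x) \<le> rip x x)"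
    and "hermitian_mat n (abs_mat X)"
proof -
  have X': "mat_adjoint X \<in> carrier_mat n n" using X by simp
  have "psd_mat n (mat_adjoint X * X)"
  proof (rule psd_matI)
    show "mat_adjoint (mat_adjoint X * X) = mat_adjoint X * X"
      using X X' by (simp add: mat_adjoint_mult[of _ n n _ n])
    fix x :: "complex vec" assume x: "x \<in> carrier_vec n"
    have "rip ((mat_adjoint X * X) *\<^sub>v x) x = rip (X *\<^sub>v x) (X *\<^sub>v x)"
      using rip_adjoint[OF X' _ x, of "X *\<^sub>v x"] X X' x by (simp add: assoc_mult_mat_vec[of _ n n _ n])
    then show "0 \<le> rip ((mat_adjoint X * X) *\<^sub>v x) x"
      using rip_self_nonneg[of "X *\<^sub>v x" n] X x by simp
  qed (use X X' in simp)
  then obtain W s where W: "unitary_mat n W" and XX: "mat_adjoint X * X = spec_mat n W s"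
    and s: "\<And>i. i < n \<Longrightarrow> 0 \<le> s i"
    using psd_spectral[of n "mat_adjoint X * X"] by auto
  have Wc: "W \<in> carrier_mat n n" "mat_adjoint W \<in> carrier_mat n n"
    using W by (auto simp: unitary_mat_def)
  have abs: "abs_mat X = spec_mat n W (\<lambda>i. sqrt (s i))"
    by (simp add: abs_mat_def XX fun_calc_spec_mat[OF W])
  then show "hermitian_mat n (abs_mat X)"
    using Wc by (simp add: hermitian_mat_def mat_adjoint_spec_mat)
  \<comment> \<open>\<open>R\<close> is the pseudo-inverse of the absolute value, since \<open>1 / sqrt 0 = 0\<close>.\<close>
  define R where "R = spec_mat n W (\<lambda>i. 1 / sqrt (s i))"
  have R: "R \<in> carrier_mat n n" "mat_adjoint R = R"
    using Wc by (auto simp: R_def mat_adjoint_spec_mat)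
  define U where "U = X * R"
  have Uc: "U \<in> carrier_mat n n" using X R by (simp add: U_def)
  have adjU: "mat_adjoint U = R * mat_adjoint X"
    using mat_adjoint_mult[OF X R(1)] R by (simp add: U_def)
  have UX: "mat_adjoint U * X = spec_mat n W (\<lambda>i. 1 / sqrt (s i) * s i)"
    using R X X' by (simp add: adjU assoc_mult_mat[of _ n n _ n _ n] XX)
      (simp add: R_def spec_mat_mult[OF W])
  have "1 / sqrt (s i) * s i = sqrt (s i)" if "i < n" for i
    using s[OF that] by (simp add: real_div_sqrt)
  then have "mat_adjoint U * X = abs_mat X"
    unfolding UX abs by (intro spec_mat_cong[OF Wc(1)])
  moreover have "rip (U *\<^sub>v x) (U *\<^sub>v x) \<le> rip x x" if x: "x \<in> carrier_vec n" for x
  proof -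
    \<comment> \<open>For \<open>i < n\<close> this is 1 if \<open>s i > 0\<close> and 0 if
      \<open>s i = 0\<close>, so \<open>mat_adjoint U * U\<close> is a projection.\<close>
    let ?t = "\<lambda>i. 1 / sqrt (s i) * s i * (1 / sqrt (s i))"
    have "mat_adjoint U * U = mat_adjoint U * X * R"
      using R X X' Uc by (simp add: U_def assoc_mult_mat[of _ n n _ n _ n])
    then have UU: "mat_adjoint U * U = spec_mat n W ?t"
      unfolding UX by (simp add: R_def spec_mat_mult[OF W])
    have t: "?t i \<le> 1" if "i < n" for i
      using s[OF that] by (cases "s i = 0") auto
    have "rip (U *\<^sub>v x) (U *\<^sub>v x) = rip ((mat_adjoint U * U) *\<^sub>v x) x"
      using rip_adjoint[of "mat_adjoint U" n n "U *\<^sub>v x" x] Uc x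
      by (simp add: assoc_mult_mat_vec[of _ n n _ n])
    also have "\<dots> = (\<Sum>i<n. ?t i * (cmod ((mat_adjoint W *\<^sub>v x) $ i))\<^sup>2)"
      by (simp only: UU rip_spec_mat[OF Wc(1) x])
    also have "\<dots> \<le> (\<Sum>i<n. 1 * (cmod ((mat_adjoint W *\<^sub>v x) $ i))\<^sup>2)"
      using t by (intro sum_mono mult_right_mono) auto
    also have "\<dots> = rip x x" by (simp add: rip_self_unitary[OF W x])
    finally show ?thesis .
  qed
  ultimately show "\<exists>U \<in> carrier_mat n n. mat_adjoint U * X = abs_mat X
           \<and> (\<forall>x \<in> carrier_vec n. rip (U *\<^sub>v x) (U *\<^sub>v x) \<le> rip x x)"
    using Uc by blast
qed

subsection \<open>Quadratic forms\<close>

lemma smult_mat_mult_vec: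
  fixes A :: "complex mat"
  assumes "A \<in> carrier_mat n m" "x \<in> carrier_vec m"
  shows "(c \<cdot>\<^sub>m A) *\<^sub>v x = c \<cdot>\<^sub>v (A *\<^sub>v x)"
  using assms by (intro eq_vecI) (auto simp: scalar_prod_def sum_distrib_left mult.assoc)

lemma hermitian_rip_swap:
  assumes "M \<in> carrier_mat n n" "mat_adjoint M = M" "x \<in> carrier_vec n" "y \<in> carrier_vec n"
  shows "rip (M *\<^sub>v x) y = rip (M *\<^sub>v y) x"
  using rip_adjoint[of M n n x y] rip_comm[of x n "M *\<^sub>v y"] assms by simp

lemma rip_combination:
  assumes M: "M \<in> carrier_mat n n" "mat_adjoint M = M" and x: "x \<in> carrier_vec n" and y: "y \<in> carrier_vec n"
  shows "rip (M *\<^sub>v (complex_of_real a \<cdot>\<^sub>v x + complex_of_real b \<cdot>\<^sub>v y))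
      (complex_of_real a \<cdot>\<^sub>v x + complex_of_real b \<cdot>\<^sub>v y)
    = a\<^sup>2 * rip (M *\<^sub>v x) x + 2 * (a * b) * rip (M *\<^sub>v x) y + b\<^sup>2 * rip (M *\<^sub>v y) y"
proof -
  have "M *\<^sub>v (complex_of_real a \<cdot>\<^sub>v x + complex_of_real b \<cdot>\<^sub>v y)
      = complex_of_real a \<cdot>\<^sub>v (M *\<^sub>v x) + complex_of_real b \<cdot>\<^sub>v (M *\<^sub>v y)"
    using M x y by (simp add: mult_add_distrib_mat_vec[of _ n n] mult_mat_vec[of _ n n])
  moreover have "M *\<^sub>v x \<in> carrier_vec n" "M *\<^sub>v y \<in> carrier_vec n" using M x y by auto
  ultimately show ?thesis
    using x y hermitian_rip_swap[OF M x y]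
    by (simp add: rip_add_left[of _ n] rip_add_right[of _ n] rip_smult_left[of _ n]
        rip_smult_right[of _ n] power2_eq_square algebra_simps)
qed

lemma rip_combination_self:
  assumes x: "x \<in> carrier_vec n" and y: "y \<in> carrier_vec n"
  shows "rip (complex_of_real a \<cdot>\<^sub>v x + complex_of_real b \<cdot>\<^sub>v y)
      (complex_of_real a \<cdot>\<^sub>v x + complex_of_real b \<cdot>\<^sub>v y)
    = a\<^sup>2 * rip x x + 2 * (a * b) * rip x y + b\<^sup>2 * rip y y"
  using rip_combination[of "1\<^sub>m n" n x y a b] assms
  by (simp add: one_mult_mat_vec[of _ n])

text \<open>Split \<open>w = y + v\<close> with \<open>y = T u\<close> and
  \<open>v = D y / \<delta>\<close>. Arithmetic-geometric mean bounds on the inner products of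
  \<open>w\<close> with \<open>y\<close> and \<open>v\<close> leave multiples of \<open>k\<close>,
  which \<open>4 * k \<le> rip w w\<close> absorbs. The factor 2 on the left pays for the term
  \<open>- \<mu>\<close> in the lower bound for \<open>P\<close>.\<close>

lemma pivot_estimate:
  assumes D: "psd_mat n D" and T: "T \<in> carrier_mat n n" "mat_adjoint T = T"
    and u: "u \<in> carrier_vec n"
    and pos: "0 < \<delta>" "0 < \<epsilon>" "0 < k"
    and u_le: "\<epsilon> * rip u u \<le> k"
    and k: "k = rip (D *\<^sub>v (T *\<^sub>v u)) (T *\<^sub>v u) / \<delta>"
    and w: "w = T *\<^sub>v u + complex_of_real (1 / \<delta>) \<cdot>\<^sub>v (D *\<^sub>v (T *\<^sub>v u))"
  shows "w \<noteq> 0\<^sub>v n"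
    and "2 * (\<delta> * \<epsilon> * rip w w) \<le> \<epsilon> * rip (D *\<^sub>v w) w + \<delta> * rip (T *\<^sub>v w) (T *\<^sub>v w)"
proof -
  define y where "y = T *\<^sub>v u"
  define v where "v = complex_of_real (1 / \<delta>) \<cdot>\<^sub>v (D *\<^sub>v y)"
  note Dp = psd_matD[OF D]
  have c: "y \<in> carrier_vec n" "D *\<^sub>v y \<in> carrier_vec n" "v \<in> carrier_vec n"
    using Dp T u by (auto simp: y_def v_def)
  have wyv: "w = y + v" by (simp add: w y_def v_def)
  have wc: "w \<in> carrier_vec n" using c by (simp add: wyv)
  have Tw: "T *\<^sub>v w \<in> carrier_vec n" using T wc by simp
  have vy: "rip v y = k"
    using c by (simp add: v_def rip_smult_left[of _ n] k y_def del: of_real_divide)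
  have ww: "rip w w = rip y y + 2 * k + rip v v"
    using c vy rip_comm[of y n v] by (simp add: wyv rip_add_left[of _ n] rip_add_right[of _ n])
  \<comment> \<open>The square of \<open>y - v\<close> differs from that of \<open>y + v\<close> by
    four times the inner product of \<open>v\<close> and \<open>y\<close>, which is
    \<open>k\<close>.\<close>
  have "0 \<le> rip (complex_of_real 1 \<cdot>\<^sub>v y + complex_of_real (-1) \<cdot>\<^sub>v v)
      (complex_of_real 1 \<cdot>\<^sub>v y + complex_of_real (-1) \<cdot>\<^sub>v v)"
    using c by (intro rip_self_nonneg[of _ n]) auto
  then have ww4: "4 * k \<le> rip w w"
    unfolding rip_combination_self[OF c(1,3)] using ww vy rip_comm[OF c(1,3)] by simp
  then show "w \<noteq> 0\<^sub>v n"
    using pos by (auto simp: rip_def)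
  \<comment> \<open>The weight \<open>\<epsilon>\<close> on \<open>u\<close> is chosen so that the
    error is \<open>\<epsilon>\<close> times \<open>\<epsilon> * rip u u\<close>, to which
    \<open>u_le\<close> applies.\<close>
  have "0 \<le> rip (complex_of_real (1/2) \<cdot>\<^sub>v (T *\<^sub>v w) + complex_of_real (-\<epsilon>) \<cdot>\<^sub>v u)
      (complex_of_real (1/2) \<cdot>\<^sub>v (T *\<^sub>v w) + complex_of_real (-\<epsilon>) \<cdot>\<^sub>v u)"
    using Tw u by (intro rip_self_nonneg[of _ n]) auto
  then have "\<epsilon> * rip (T *\<^sub>v w) u \<le> rip (T *\<^sub>v w) (T *\<^sub>v w) / 4 + \<epsilon> * (\<epsilon> * rip u u)"
    unfolding rip_combination_self[OF Tw u] by (simp add: power2_eq_square algebra_simps)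
  also have "\<dots> \<le> rip (T *\<^sub>v w) (T *\<^sub>v w) / 4 + \<epsilon> * k"
    using u_le pos by simp
  also have "rip (T *\<^sub>v w) u = rip w y"
    using rip_adjoint[OF T(1) wc u] T(2) by (simp add: y_def)
  finally have wy: "\<epsilon> * rip w y \<le> rip (T *\<^sub>v w) (T *\<^sub>v w) / 4 + \<epsilon> * k" .
  \<comment> \<open>The same square in the semidefinite form of \<open>D\<close>. Its error is the
    value of that form at \<open>y\<close>, which is \<open>\<delta> * k\<close>.\<close>
  have "0 \<le> rip (D *\<^sub>v (complex_of_real (1/2) \<cdot>\<^sub>v w + complex_of_real (-1) \<cdot>\<^sub>v y))
      (complex_of_real (1/2) \<cdot>\<^sub>v w + complex_of_real (-1) \<cdot>\<^sub>v y)"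
    using wc c by (intro Dp(3)) auto
  then have "rip (D *\<^sub>v w) y \<le> rip (D *\<^sub>v w) w / 4 + rip (D *\<^sub>v y) y"
    unfolding rip_combination[OF Dp(1,2) wc c(1)] by (simp add: power2_eq_square)
  also have "rip (D *\<^sub>v w) y = \<delta> * rip w v"
    using hermitian_rip_swap[OF Dp(1,2) wc c(1)] rip_comm[OF c(2) wc] wc c pos
    by (simp add: v_def rip_smult_right[of _ n] del: of_real_divide)
  also have "rip (D *\<^sub>v y) y = \<delta> * k" using pos by (simp add: k y_def)
  finally have wv: "\<delta> * rip w v \<le> rip (D *\<^sub>v w) w / 4 + \<delta> * k" .
  have "rip w w = rip w y + rip w v" using rip_add_right[OF c(1,3) wc] wyv by simp
  then have "\<delta> * \<epsilon> * rip w w = \<delta> * (\<epsilon> * rip w y) + \<epsilon> * (\<delta> * rip w v)"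
    by (simp add: algebra_simps)
  also have "\<dots> \<le> \<delta> * (rip (T *\<^sub>v w) (T *\<^sub>v w) / 4 + \<epsilon> * k) + \<epsilon> * (rip (D *\<^sub>v w) w / 4 + \<delta> * k)"
    using wy wv pos by (intro add_mono mult_left_mono) auto
  \<comment> \<open>The two errors together are half of
    \<open>\<delta> * \<epsilon> * (4 * k)\<close>, so \<open>ww4\<close> bounds them by half of the
    quantity being estimated.\<close>
  also have "\<dots> = (\<epsilon> * rip (D *\<^sub>v w) w + \<delta> * rip (T *\<^sub>v w) (T *\<^sub>v w)) / 4 + \<delta> * \<epsilon> * (4 * k) / 2"
    by (simp add: field_simps)
  also have "\<dots> \<le> (\<epsilon> * rip (D *\<^sub>v w) w + \<delta> * rip (T *\<^sub>v w) (T *\<^sub>v w)) / 4 + \<delta> * \<epsilon> * rip w w / 2"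
    using ww4 pos by (intro add_left_mono divide_right_mono mult_left_mono) auto
  finally show "2 * (\<delta> * \<epsilon> * rip w w) \<le> \<epsilon> * rip (D *\<^sub>v w) w + \<delta> * rip (T *\<^sub>v w) (T *\<^sub>v w)"
    by (simp only: field_simps)
qed

subsection \<open>Scalar inequalities\<close>

text \<open>With \<open>\<epsilon> = \<mu> / \<delta>\<close>, the sign condition at
  \<open>i\<close> says that \<open>\<delta>\<close> lies in the closed interval between
  \<open>p i\<close> and \<open>\<mu> / q i\<close>, the latter read as infinite when
  \<open>q i = 0\<close>. Comparability makes these intervals meet pairwise, and Helly's theorem on
  the line gives a common point: the largest left endpoint.\<close>

lemma monotone_pivot:
  fixes p q :: "nat \<Rightarrow> real"
  assumes nonneg: "\<And>i. i < n \<Longrightarrow> 0 \<le> p i" "\<And>i. i < n \<Longrightarrow> 0 \<le> q i"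
    and chain: "\<And>i j. i < n \<Longrightarrow> j < n \<Longrightarrow> (p i \<le> p j \<and> q i \<le> q j) \<or> (p j \<le> p i \<and> q j \<le> q i)"
    and \<mu>: "0 < \<mu>"
  shows "\<exists>\<delta> \<epsilon>. 0 < \<delta> \<and> 0 < \<epsilon> \<and> \<delta> * \<epsilon> = \<mu> \<and> (\<forall>i<n. 0 \<le> (p i - \<delta>) * (q i - \<epsilon>))"
proof -
  \<comment> \<open>The left endpoint. An index with \<open>q i = 0\<close> falls into the first
    case, so no division by zero occurs.\<close>
  define l where "l i = (if p i * q i \<le> \<mu> then p i else \<mu> / q i)" for i
  \<comment> \<open>\<open>\<kappa>\<close> keeps \<open>\<delta>\<close> positive even when every
    \<open>p i\<close> is zero. Its denominator exceeds every \<open>q j\<close>, which puts it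
    below every right endpoint.\<close>
  define \<kappa> where "\<kappa> = \<mu> / (1 + (\<Sum>i<n. q i))"
  have S: "0 \<le> (\<Sum>i<n. q i)" using nonneg by (intro sum_nonneg) auto
  then have \<kappa>: "0 < \<kappa>" using \<mu> by (simp add: \<kappa>_def)
  have qS: "q j \<le> 1 + (\<Sum>i<n. q i)" if "j < n" for j
    using member_le_sum[of j "{..<n}" q] nonneg that by auto
  let ?M = "insert \<kappa> (l ` {..<n})"
  define \<delta> where "\<delta> = Max ?M"
  have fin: "finite ?M" by simp
  have ge: "m \<le> \<delta>" if "m \<in> ?M" for m using Max_ge[OF fin that] by (simp add: \<delta>_def)
  have mem: "\<delta> \<in> ?M" using Max_in[OF fin] by (simp add: \<delta>_def)
  have \<delta>: "0 < \<delta>" using ge[of \<kappa>] \<kappa> by simp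
  have q_pos: "0 < q i" if "i < n" "\<not> p i * q i \<le> \<mu>" for i
    using nonneg[OF that(1)] that(2) \<mu> by (cases "q i = 0") auto
  \<comment> \<open>Every candidate for \<open>\<delta>\<close> lies below every right endpoint. The
    endpoint \<open>\<mu> / q j\<close> appears multiplied out because \<open>q j\<close> may
    vanish.\<close>
  have bound: "if p j * q j \<le> \<mu> then m * q j \<le> \<mu> else m \<le> p j" if j: "j < n" and m: "m \<in> ?M" for m j
  proof (cases "m = \<kappa>")
    case True
    have "\<mu> * q j \<le> \<mu> * (1 + (\<Sum>i<n. q i))" using qS[OF j] \<mu> by simp
    then have 1: "\<kappa> * q j \<le> \<mu>" using S by (simp add: \<kappa>_def divide_le_eq)
    moreover have "\<kappa> \<le> p j" if "\<not> p j * q j \<le> \<mu>"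
      using 1 that q_pos[OF j that] by (meson mult_le_cancel_right_pos le_less_trans not_le order.trans less_imp_le)
    ultimately show ?thesis using True by simp
  next
    case False
    then obtain i where i: "i < n" and m: "m = l i" using m by auto
    note ni = nonneg[OF i] and nj = nonneg[OF j]
    show ?thesis
    proof (cases "p i * q i \<le> \<mu>")
      case True
      have 1: "p i * q j \<le> max (p j * q j) (p i * q i)"
        using chain[OF i j] mult_right_mono[of "p i" "p j" "q j"] mult_left_mono[of "q j" "q i" "p i"] ni nj
        by (auto simp: le_max_iff_disj)
      have 2: "p i \<le> p j" if "\<not> p j * q j \<le> \<mu>"
        using chain[OF i j] mult_mono[of "p j" "p i" "q j" "q i"] True that ni nj by auto
      show ?thesis using 1 2 True by (auto simp: m l_def)
    next
      case False
      note qi = q_pos[OF i False]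
      have 1: "q j \<le> q i" if "p j * q j \<le> \<mu>"
        using chain[OF i j] mult_mono[of "p i" "p j" "q i" "q j"] False that ni nj by auto
      have 2: "\<mu> \<le> p j * q i" if "\<not> p j * q j \<le> \<mu>"
        using chain[OF i j] mult_left_mono[of "q j" "q i" "p j"] mult_right_mono[of "p i" "p j" "q i"]
          False that ni nj by auto
      show ?thesis using 1 2 False qi \<mu> by (auto simp: m l_def field_simps)
    qed
  qed
  have "0 \<le> (p j - \<delta>) * (q j - \<mu> / \<delta>)" if j: "j < n" for j
  proof (cases "p j * q j \<le> \<mu>")
    case True
    then have "p j \<le> \<delta>" "\<delta> * q j \<le> \<mu>" using ge[of "l j"] bound[OF j mem] j by (auto simp: l_def)
    then show ?thesis using \<delta> by (intro mult_nonpos_nonpos) (auto simp: field_simps)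
  next
    case False
    then have "\<mu> / q j \<le> \<delta>" "\<delta> \<le> p j" using ge[of "l j"] bound[OF j mem] j by (auto simp: l_def)
    then show ?thesis using \<delta> q_pos[OF j False] by (intro mult_nonneg_nonneg) (auto simp: field_simps)
  qed
  then show ?thesis using \<delta> \<mu> by (intro exI[of _ \<delta>] exI[of _ "\<mu> / \<delta>"]) auto
qed

text \<open>For \<open>t > 0\<close>, \<open>s\<close> is a convex combination of 0 and
  \<open>t\<close>, and \<open>h 0\<close> is non-negative. This is the decrease of
  \<open>h t / t\<close>, multiplied out to allow zero arguments; it later makes \<open>B/A\<close>
  increase with \<open>B\<close>.\<close>

lemma concave_nonneg_slope:
  fixes h :: "real \<Rightarrow> real"
  assumes h: "h \<in> {0..} \<rightarrow> {0..}" "concave_on {0..} h" and st: "0 \<le> s" "s \<le> t"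
  shows "s * h t \<le> t * h s"
proof (cases "t = 0")
  case False
  then have t: "0 < t" using st by simp
  have "(1 - s / t) * h 0 + (s / t) * h t \<le> h ((1 - s / t) *\<^sub>R 0 + (s / t) *\<^sub>R t)"
    using st t by (intro concave_onD[OF h(2)]) auto
  moreover have "0 \<le> (1 - s / t) * h 0" using h(1) st t by (intro mult_nonneg_nonneg) auto
  ultimately have "(s / t) * h t \<le> h s" using t by simp
  then show ?thesis using t by (simp add: field_simps)
qed (use st in simp)

text \<open>After a drop from \<open>s\<close> to \<open>t\<close>, concavity would force
  \<open>h\<close> to fall at least linearly and become negative far to the right.\<close>

lemma concave_nonneg_mono:
  fixes h :: "real \<Rightarrow> real"
  assumes h: "h \<in> {0..} \<rightarrow> {0..}" "concave_on {0..} h" and st: "0 \<le> s" "s \<le> t"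
  shows "h s \<le> h t"
proof (rule ccontr)
  assume "\<not> h s \<le> h t"
  then have less: "h t < h s" and t: "s < t" using st by (cases "s = t", auto)+
  have h0: "0 \<le> h t" using h(1) st by auto
  \<comment> \<open>Half the relative drop, so that \<open>(1 - r) * h s\<close> is the mean of
    \<open>h s\<close> and \<open>h t\<close>, still above \<open>h t\<close>. The point
    \<open>z\<close> below is chosen so that \<open>t\<close> divides the segment from
    \<open>s\<close> to \<open>z\<close> in the proportion \<open>r\<close>.\<close>
  define r where "r = (h s - h t) / (2 * h s)"
  have hs: "0 < h s" using less h0 by simp
  then have r: "0 < r" "r < 1" using less h0 by (auto simp: r_def field_simps)
  define z where "z = s + (t - s) / r"
  have z: "0 \<le> z" using st r by (simp add: z_def)
  have "(1 - r) * h s + r * h z \<le> h ((1 - r) *\<^sub>R s + r *\<^sub>R z)"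
    using st r z by (intro concave_onD[OF h(2)]) auto
  also have "(1 - r) *\<^sub>R s + r *\<^sub>R z = t" using r by (simp add: z_def field_simps)
  finally have "(1 - r) * h s + r * h z \<le> h t" .
  moreover have "0 \<le> r * h z" using h(1) z r by (intro mult_nonneg_nonneg) auto
  ultimately have "(1 - r) * h s \<le> h t" by linarith
  moreover have "r * h s = (h s - h t) / 2" using hs by (simp add: r_def field_simps)
  ultimately have "h s - (h s - h t) / 2 \<le> h t" by (simp only: left_diff_distrib mult_1)
  then show False using less by (simp add: field_simps)
qed

text \<open>Monotonicity settles the points left of \<open>s\<close>, the slope bound those to its
  right. This isolates the degenerate case of the quotient \<open>B/A\<close>.\<close>

lemma concave_nonneg_zero:
  fixes h :: "real \<Rightarrow> real"
  assumes h: "h \<in> {0..} \<rightarrow> {0..}" "concave_on {0..} h" and s: "0 < s" "h s = 0" and t: "0 \<le> t"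
  shows "h t = 0"
proof -
  have "h t \<le> 0"
  proof (cases "t \<le> s")
    case True
    then show ?thesis using concave_nonneg_mono[OF h t True] s by simp
  next
    case False
    then have "s * h t \<le> 0" using concave_nonneg_slope[OF h, of s t] s by simp
    then show ?thesis using s by (simp add: mult_le_0_iff)
  qed
  moreover have "0 \<le> h t" using h(1) t by auto
  ultimately show ?thesis by simp
qed

subsection \<open>Positive maps on a commutative subalgebra\<close>

text \<open>Such a functional is determined by its values at the indicators of single indices; the
  induction adds one coordinate at a time to a truncation of \<open>a\<close>.\<close>

lemma linear_functional_expansion:
  fixes L :: "(nat \<Rightarrow> real) \<Rightarrow> real"
  assumes add: "\<And>a b. L (\<lambda>i. a i + b i) = L a + L b"
    and scale: "\<And>c a. L (\<lambda>i. c * a i) = c * L a"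
    and cong: "\<And>a b. (\<And>i. i < n \<Longrightarrow> a i = b i) \<Longrightarrow> L a = L b"
  shows "L a = (\<Sum>i<n. a i * L (\<lambda>k. if k = i then 1 else 0))"
proof -
  have "L (\<lambda>k. if k < m then a k else 0) = (\<Sum>i<m. a i * L (\<lambda>k. if k = i then 1 else 0))" for m
  proof (induction m)
    case 0
    show ?case using scale[of 0 "\<lambda>_. 0"] by simp
  next
    case (Suc m)
    have "(\<lambda>k. if k < Suc m then a k else 0)
        = (\<lambda>k. (if k < m then a k else 0) + a m * (if k = m then 1 else 0))"
      by (auto simp: less_Suc_eq)
    then have "L (\<lambda>k. if k < Suc m then a k else 0)
        = L (\<lambda>k. if k < m then a k else 0) + a m * L (\<lambda>k. if k = m then 1 else 0)"
      by (simp only: add scale)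
    then show ?case using Suc by simp
  qed
  from this[of n] show ?thesis using cong[of a "\<lambda>k. if k < n then a k else 0"] by simp
qed

locale positive_linear_map =
  fixes n d :: nat and \<Phi> :: "complex mat \<Rightarrow> complex mat" and U :: "complex mat"
  assumes linear: "linear_mat_map n d \<Phi>"
    and positive: "positive_mat_map n d \<Phi>"
    and unital: "unital_mat_map n d \<Phi>"
    and unitary: "unitary_mat n U"
begin

text \<open>The restriction of \<open>\<Phi>\<close> to the commutative algebra diagonal in the
  basis \<open>U\<close>. Indicators give the images of the spectral projections: positive matrices
  that sum to the identity.\<close>

definition F :: "(nat \<Rightarrow> real) \<Rightarrow> complex mat" where
  "F a = \<Phi> (spec_mat n U a)"

lemma U_carrier: "U \<in> carrier_mat n n"
  using unitary by (simp add: unitary_mat_def)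

lemma F_carrier [simp]: "F a \<in> carrier_mat d d"
  using linear spec_mat_carrier[OF U_carrier] by (auto simp: F_def linear_mat_map_def)

lemma F_psd: "(\<And>i. i < n \<Longrightarrow> 0 \<le> a i) \<Longrightarrow> psd_mat d (F a)"
  using positive psd_spec_mat[OF U_carrier] by (simp add: F_def positive_mat_map_def)

lemma F_cong: "(\<And>i. i < n \<Longrightarrow> a i = b i) \<Longrightarrow> F a = F b"
  unfolding F_def using spec_mat_cong[OF U_carrier] by metis

lemma F_one: "F (\<lambda>_. 1) = 1\<^sub>m d"
  using unital by (simp add: F_def spec_mat_one[OF unitary] unital_mat_map_def)

lemma rip_F_add:
  assumes "x \<in> carrier_vec d" "y \<in> carrier_vec d"
  shows "rip (F (\<lambda>i. a i + b i) *\<^sub>v x) y = rip (F a *\<^sub>v x) y + rip (F b *\<^sub>v x) y"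
proof -
  have "F (\<lambda>i. a i + b i) = F a + F b"
    using linear spec_mat_carrier[OF U_carrier]
    by (simp add: F_def spec_mat_add[OF U_carrier] linear_mat_map_def)
  then show ?thesis
    using assms by (simp add: add_mult_distrib_mat_vec[of _ d d] rip_add_left[of _ d])
qed

lemma rip_F_scale:
  assumes "x \<in> carrier_vec d" "y \<in> carrier_vec d"
  shows "rip (F (\<lambda>i. c * a i) *\<^sub>v x) y = c * rip (F a *\<^sub>v x) y"
proof -
  have "F (\<lambda>i. c * a i) = complex_of_real c \<cdot>\<^sub>m F a"
    using linear spec_mat_carrier[OF U_carrier]
    by (simp add: F_def spec_mat_smult[OF U_carrier] linear_mat_map_def)
  then have "F (\<lambda>i. c * a i) *\<^sub>v x = complex_of_real c \<cdot>\<^sub>v (F a *\<^sub>v x)"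
    using smult_mat_mult_vec[OF F_carrier assms(1)] by simp
  then show ?thesis
    using assms by (simp add: rip_smult_left[of _ d])
qed

lemma rip_F_expansion:
  assumes "x \<in> carrier_vec d" "y \<in> carrier_vec d"
  shows "rip (F a *\<^sub>v x) y = (\<Sum>i<n. a i * rip (F (\<lambda>k. if k = i then 1 else 0) *\<^sub>v x) y)"
  by (rule linear_functional_expansion[where L = "\<lambda>a. rip (F a *\<^sub>v x) y"])
    (simp_all add: rip_F_add[OF assms] rip_F_scale[OF assms] cong: F_cong)

text \<open>With \<open>E i\<close> the image of the \<open>i\<close>-th spectral projection, the left-hand side is the sum of the
  values of the forms \<open>E i\<close> at \<open>r i x + s i y\<close>.\<close>

lemma F_block_nonneg:
  assumes x: "x \<in> carrier_vec d" and y: "y \<in> carrier_vec d"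
  shows "0 \<le> rip (F (\<lambda>i. (r i)\<^sup>2) *\<^sub>v x) x + 2 * rip (F (\<lambda>i. r i * s i) *\<^sub>v x) y
      + rip (F (\<lambda>i. (s i)\<^sup>2) *\<^sub>v y) y"
proof -
  let ?E = "\<lambda>i. F (\<lambda>k. if k = i then 1 else 0)"
  have "0 \<le> (r i)\<^sup>2 * rip (?E i *\<^sub>v x) x + 2 * (r i * s i) * rip (?E i *\<^sub>v x) y
      + (s i)\<^sup>2 * rip (?E i *\<^sub>v y) y" for i
  proof -
    have E: "psd_mat d (?E i)" by (rule F_psd) simp
    let ?z = "complex_of_real (r i) \<cdot>\<^sub>v x + complex_of_real (s i) \<cdot>\<^sub>v y"
    have "0 \<le> rip (?E i *\<^sub>v ?z) ?z" using x y by (intro psd_matD(3)[OF E]) auto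
    then show ?thesis by (simp only: rip_combination[OF psd_matD(1,2)[OF E] x y])
  qed
  then have "0 \<le> (\<Sum>i<n. (r i)\<^sup>2 * rip (?E i *\<^sub>v x) x + 2 * (r i * s i) * rip (?E i *\<^sub>v x) y
      + (s i)\<^sup>2 * rip (?E i *\<^sub>v y) y)"
    by (intro sum_nonneg) auto
  then show ?thesis
    unfolding rip_F_expansion[OF x x, of "\<lambda>i. (r i)\<^sup>2"] rip_F_expansion[OF x y, of "\<lambda>i. r i * s i"]
      rip_F_expansion[OF y y, of "\<lambda>i. (s i)\<^sup>2"]
    by (simp add: sum.distrib sum_distrib_left mult.assoc)
qed

text \<open>The block form of the functions \<open>a\<close> and \<open>-1\<close>, evaluated at
  \<open>w\<close> and \<open>F a w\<close>. As \<open>\<Phi>\<close> is unital, the last term is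
  the squared norm of \<open>F a w\<close> and cancels half of the cross term.\<close>

lemma Kadison_inequality:
  assumes w: "w \<in> carrier_vec d" and a: "\<And>i. i < n \<Longrightarrow> 0 \<le> a i"
  shows "rip (F a *\<^sub>v w) (F a *\<^sub>v w) \<le> rip (F (\<lambda>i. (a i)\<^sup>2) *\<^sub>v w) w"
proof -
  have v: "F a *\<^sub>v w \<in> carrier_vec d" using w by simp
  have "F (\<lambda>i. (- 1)\<^sup>2) = 1\<^sub>m d" by (simp add: F_one)
  moreover have "rip (F (\<lambda>i. a i * - 1) *\<^sub>v w) (F a *\<^sub>v w) = - rip (F a *\<^sub>v w) (F a *\<^sub>v w)"
    using rip_F_scale[OF w v, of "-1" a] by simp
  ultimately show ?thesis
    using F_block_nonneg[OF w v, of a "\<lambda>_. - 1"] v by (simp add: one_mult_mat_vec[OF v])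
qed

text \<open>\<open>a\<close> and \<open>b\<close> are the eigenvalues of \<open>A\<close> and
  \<open>B\<close> in a common basis. The condition \<open>zero\<close> guards the convention
  \<open>b / 0 = 0\<close>: either \<open>F a\<close> vanishes, or \<open>b i\<close> is the
  geometric mean of \<open>a i * b i\<close> and \<open>b i / a i\<close> at every index.\<close>

lemma abs_product_le:
  fixes a b :: "nat \<Rightarrow> real"
  assumes a0: "\<And>i. i < n \<Longrightarrow> 0 \<le> a i" and b0: "\<And>i. i < n \<Longrightarrow> 0 \<le> b i"
    and chain: "\<And>i j. i < n \<Longrightarrow> j < n \<Longrightarrow>
      (b i / a i \<le> b j / a j \<and> a i \<le> a j) \<or> (b j / a j \<le> b i / a i \<and> a j \<le> a i)"
    and zero: "(\<forall>i<n. a i = 0) \<or> (\<forall>i<n. a i = 0 \<longrightarrow> b i = 0)"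
  defines "P \<equiv> F (\<lambda>i. a i * b i)"
  shows "\<exists>V. unitary_mat d V \<and>
    loewner_le d (abs_mat (F a * F b)) ((1 / 2) \<cdot>\<^sub>m (P + V * P * mat_adjoint V))"
proof -
  define D where "D = F (\<lambda>i. b i / a i)"
  define T where "T = F a"
  define X where "X = T * F b"
  have Pp: "psd_mat d P" unfolding P_def using a0 b0 by (intro F_psd) simp
  have Dp: "psd_mat d D" unfolding D_def using a0 b0 by (intro F_psd) simp
  have "psd_mat d T" unfolding T_def using a0 by (intro F_psd)
  note T = psd_matD(1,2)[OF this]
  note P = psd_matD(1,2)[OF Pp] and D = psd_matD(1,2)[OF Dp]
  have Xc: "X \<in> carrier_mat d d" using T by (simp add: X_def)

  \<comment> \<open>Block positivity linking \<open>P\<close>, \<open>X\<close> and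
    \<open>T D T\<close>\<close>
  have block: "0 \<le> rip (P *\<^sub>v x) x - 2 * rip (X *\<^sub>v x) u + rip (D *\<^sub>v (T *\<^sub>v u)) (T *\<^sub>v u)"
    if x: "x \<in> carrier_vec d" and u: "u \<in> carrier_vec d" for x u
  proof -
    have Tu: "T *\<^sub>v u \<in> carrier_vec d" and Qx: "F b *\<^sub>v x \<in> carrier_vec d" using T x u by auto
    have Xx: "X *\<^sub>v x = T *\<^sub>v (F b *\<^sub>v x)"
      unfolding X_def using T x by (intro assoc_mult_mat_vec[of _ d d _ d]) auto
    show ?thesis
      using zero
    proof
      assume a: "\<forall>i<n. a i = 0"
      have "rip (X *\<^sub>v x) u = 0"
        unfolding Xx T_def rip_F_expansion[OF Qx u, of a] using a by simp
      then show ?thesis using psd_matD(3)[OF Pp x] psd_matD(3)[OF Dp Tu] by simp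
    next
      assume ab: "\<forall>i<n. a i = 0 \<longrightarrow> b i = 0"
      \<comment> \<open>The scalar matrix with rows \<open>(ab, b)\<close> and
        \<open>(b, b/a)\<close> has rank at most one and factors through the vector
        \<open>(r, s)\<close>. Using \<open>- s\<close> gives the cross term its minus sign.\<close>
      define r where "r i = sqrt (a i * b i)" for i
      define s where "s i = sqrt (b i / a i)" for i
      have "F (\<lambda>i. (r i)\<^sup>2) = P"
        unfolding P_def r_def using a0 b0 by (intro F_cong) simp
      moreover have "F (\<lambda>i. (- s i)\<^sup>2) = D"
        unfolding D_def s_def using a0 b0 by (intro F_cong) simp
      moreover have "F (\<lambda>i. r i * - s i) = F (\<lambda>i. -1 * b i)"
      proof (rule F_cong)
        fix i assume i: "i < n"
        have "r i * s i = sqrt (b i * b i)"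
          using ab i by (cases "a i = 0") (auto simp: r_def s_def simp flip: real_sqrt_mult)
        then show "r i * - s i = -1 * b i" using b0[OF i] by simp
      qed
      ultimately have "0 \<le> rip (P *\<^sub>v x) x - 2 * rip (F b *\<^sub>v x) (T *\<^sub>v u) + rip (D *\<^sub>v (T *\<^sub>v u)) (T *\<^sub>v u)"
        using F_block_nonneg[OF x Tu, of r "\<lambda>i. - s i"] rip_F_scale[OF x Tu, of "-1" b] by simp
      moreover have "rip (F b *\<^sub>v x) (T *\<^sub>v u) = rip (X *\<^sub>v x) u"
        using rip_adjoint[OF T(1) Qx u] T(2) by (simp add: Xx)
      ultimately show ?thesis by simp
    qed
  qed

  \<comment> \<open>The polar contraction and the form \<open>Z\<close>\<close>
  obtain K where K: "K \<in> carrier_mat d d" and KX: "mat_adjoint K * X = abs_mat X"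
    and contr: "\<And>x. x \<in> carrier_vec d \<Longrightarrow> rip (K *\<^sub>v x) (K *\<^sub>v x) \<le> rip x x"
    using abs_mat_contraction(1)[OF Xc] by auto
  have K': "mat_adjoint K \<in> carrier_mat d d" using K by simp
  \<comment> \<open>Chosen so that \<open>block\<close> at \<open>u = K x\<close> bounds twice the
    form of \<open>abs_mat X\<close> by the sum of the forms of \<open>P\<close> and
    \<open>Z\<close>.\<close>
  define Z where "Z = mat_adjoint K * (T * D * T) * K"
  have Z: "hermitian_mat d Z"
    using K K' T D
    by (simp add: hermitian_mat_def Z_def mat_adjoint_mult[of _ d d _ d] assoc_mult_mat[of _ d d _ d _ d])
  have Zx: "rip (Z *\<^sub>v x) x = rip (D *\<^sub>v (T *\<^sub>v (K *\<^sub>v x))) (T *\<^sub>v (K *\<^sub>v x))"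
    if x: "x \<in> carrier_vec d" for x
  proof -
    let ?u = "K *\<^sub>v x"
    have c: "?u \<in> carrier_vec d" "T *\<^sub>v ?u \<in> carrier_vec d" "D *\<^sub>v (T *\<^sub>v ?u) \<in> carrier_vec d"
      "T *\<^sub>v (D *\<^sub>v (T *\<^sub>v ?u)) \<in> carrier_vec d"
      using K T D x by auto
    have "Z *\<^sub>v x = mat_adjoint K *\<^sub>v (T *\<^sub>v (D *\<^sub>v (T *\<^sub>v ?u)))"
      unfolding Z_def using K K' T D x by (simp add: assoc_mult_mat_vec[of _ d d _ d])
    then show ?thesis
      using rip_adjoint[OF K' c(4) x] rip_adjoint[OF T(1) c(3) c(1)] T(2) by simp
  qed

  \<comment> \<open>Eigenvalue comparison of \<open>Z\<close> with \<open>P\<close>\<close>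
  have "\<exists>V. unitary_mat d V \<and>
    (\<forall>x \<in> carrier_vec d. rip (Z *\<^sub>v x) x \<le> rip ((V * P * mat_adjoint V) *\<^sub>v x) x)"
  proof (rule unitary_orbit_dominates[OF Z Pp])
    fix \<mu> :: real assume \<mu>: "0 < \<mu>"
    obtain \<delta> \<epsilon> where pos: "0 < \<delta>" "0 < \<epsilon>" and \<delta>\<epsilon>: "\<delta> * \<epsilon> = \<mu>"
      and pivot: "\<And>i. i < n \<Longrightarrow> 0 \<le> (b i / a i - \<delta>) * ((a i)\<^sup>2 - \<epsilon>)"
    proof -
      have "\<exists>\<delta> \<epsilon>. 0 < \<delta> \<and> 0 < \<epsilon> \<and> \<delta> * \<epsilon> = \<mu> \<and> (\<forall>i<n. 0 \<le> (b i / a i - \<delta>) * ((a i)\<^sup>2 - \<epsilon>))"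
      \<comment> \<open>The pivot is taken for \<open>b/a\<close> and the square of
        \<open>a\<close>, whose product is the function \<open>ab\<close> that defines
        \<open>P\<close>.\<close>
      proof (rule monotone_pivot[OF _ _ _ \<mu>])
        fix i j assume ij: "i < n" "j < n"
        show "b i / a i \<le> b j / a j \<and> (a i)\<^sup>2 \<le> (a j)\<^sup>2 \<or> b j / a j \<le> b i / a i \<and> (a j)\<^sup>2 \<le> (a i)\<^sup>2"
          using chain[OF ij] a0 ij by (auto intro: power_mono)
      qed (use a0 b0 in auto)
      then show ?thesis using that by auto
    qed
    define N where "N = T * K + complex_of_real (1 / \<delta>) \<cdot>\<^sub>m (D * T * K)"
    have Nc: "N \<in> carrier_mat d d" using K T D by (simp add: N_def)
    have P_ge: "\<epsilon> * rip (D *\<^sub>v w) w + \<delta> * rip (T *\<^sub>v w) (T *\<^sub>v w) - \<mu> * rip w w \<le> rip (P *\<^sub>v w) w"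
      if w: "w \<in> carrier_vec d" for w
    proof -
      \<comment> \<open>The expanded pivot product, valid also at \<open>a i = 0\<close> because
        then \<open>b i / a i = 0\<close>. Every summand has a form to which linearity of
        \<open>F\<close> applies.\<close>
      let ?g = "\<lambda>i. a i * b i + (- \<epsilon> * (b i / a i) + (- \<delta> * (a i)\<^sup>2 + \<mu> * 1))"
      have "?g i = (b i / a i - \<delta>) * ((a i)\<^sup>2 - \<epsilon>)" for i
        using \<delta>\<epsilon> by (cases "a i = 0") (auto simp: power2_eq_square algebra_simps)
      then have "psd_mat d (F ?g)" using pivot by (intro F_psd) simp
      from psd_matD(3)[OF this w]
      have "0 \<le> rip (P *\<^sub>v w) w + (- \<epsilon> * rip (D *\<^sub>v w) w + (- \<delta> * rip (F (\<lambda>i. (a i)\<^sup>2) *\<^sub>v w) w + \<mu> * rip w w))"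
        unfolding rip_F_add[OF w w] rip_F_scale[OF w w] F_one one_mult_mat_vec[OF w] P_def D_def .
      moreover have "\<delta> * rip (T *\<^sub>v w) (T *\<^sub>v w) \<le> \<delta> * rip (F (\<lambda>i. (a i)\<^sup>2) *\<^sub>v w) w"
        using Kadison_inequality[OF w a0] pos by (simp add: T_def)
      ultimately show ?thesis by simp
    qed
    have "N *\<^sub>v x \<noteq> 0\<^sub>v d \<and> \<mu> * rip (N *\<^sub>v x) (N *\<^sub>v x) \<le> rip (P *\<^sub>v (N *\<^sub>v x)) (N *\<^sub>v x)"
      if x: "x \<in> carrier_vec d" and x0: "x \<noteq> 0\<^sub>v d" and ge: "\<mu> * rip x x \<le> rip (Z *\<^sub>v x) x" for x
    proof -
      define u where "u = K *\<^sub>v x"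
      have u: "u \<in> carrier_vec d" using K x by (simp add: u_def)
      define k where "k = rip (D *\<^sub>v (T *\<^sub>v u)) (T *\<^sub>v u) / \<delta>"
      have k_ge: "\<epsilon> * rip x x \<le> k"
        using ge pos by (simp add: Zx[OF x] k_def u_def le_divide_eq mult_ac flip: \<delta>\<epsilon>)
      have "0 < \<epsilon> * rip x x" using rip_self_pos[OF x x0] pos by simp
      then have k0: "0 < k" using k_ge by simp
      \<comment> \<open>Contractivity of \<open>K\<close> turns the hypothesis on \<open>x\<close>
        into the one that \<open>pivot_estimate\<close> needs on \<open>u\<close>.\<close>
      have "\<epsilon> * rip u u \<le> \<epsilon> * rip x x" using contr[OF x] pos by (simp add: u_def)
      then have uk: "\<epsilon> * rip u u \<le> k" using k_ge by simp
      have c: "T *\<^sub>v u \<in> carrier_vec d" "D *\<^sub>v (T *\<^sub>v u) \<in> carrier_vec d" using T D u by auto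
      have TK: "(T * K) *\<^sub>v x = T *\<^sub>v u" and DTK: "(D * T * K) *\<^sub>v x = D *\<^sub>v (T *\<^sub>v u)"
        using K T D x by (simp_all add: u_def assoc_mult_mat_vec[of _ d d _ d])
      have "N *\<^sub>v x = (T * K) *\<^sub>v x + (complex_of_real (1 / \<delta>) \<cdot>\<^sub>m (D * T * K)) *\<^sub>v x"
        unfolding N_def using K T D x by (intro add_mult_distrib_mat_vec[of _ d d]) auto
      also have "(complex_of_real (1 / \<delta>) \<cdot>\<^sub>m (D * T * K)) *\<^sub>v x
          = complex_of_real (1 / \<delta>) \<cdot>\<^sub>v ((D * T * K) *\<^sub>v x)"
        using K T D x by (intro smult_mat_mult_vec[of _ d d]) auto
      finally have N: "N *\<^sub>v x = T *\<^sub>v u + complex_of_real (1 / \<delta>) \<cdot>\<^sub>v (D *\<^sub>v (T *\<^sub>v u))"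
        by (simp only: TK DTK)
      note est = pivot_estimate[OF Dp T u pos k0 uk k_def N]
      have w: "N *\<^sub>v x \<in> carrier_vec d" using Nc x by simp
      \<comment> \<open>The estimate supplies \<open>2 * \<mu>\<close> times the squared norm of
        \<open>N x\<close>, and \<open>P_ge\<close> takes away one \<open>\<mu>\<close> of
        it.\<close>
      show ?thesis using est P_ge[OF w] \<delta>\<epsilon> by simp
    qed
    then show "\<exists>N \<in> carrier_mat d d. \<forall>x \<in> carrier_vec d.
      x \<noteq> 0\<^sub>v d \<longrightarrow> \<mu> * rip x x \<le> rip (Z *\<^sub>v x) x \<longrightarrow>
      N *\<^sub>v x \<noteq> 0\<^sub>v d \<and> \<mu> * rip (N *\<^sub>v x) (N *\<^sub>v x) \<le> rip (P *\<^sub>v (N *\<^sub>v x)) (N *\<^sub>v x)"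
      using Nc by (intro bexI[of _ N]) auto
  qed
  then obtain V where V: "unitary_mat d V"
    and ZV: "\<And>x. x \<in> carrier_vec d \<Longrightarrow> rip (Z *\<^sub>v x) x \<le> rip ((V * P * mat_adjoint V) *\<^sub>v x) x"
    by auto

  \<comment> \<open>Passage from quadratic forms to the Loewner order\<close>
  have Vc: "V \<in> carrier_mat d d" "mat_adjoint V \<in> carrier_mat d d"
    using V by (auto simp: unitary_mat_def)
  define W where "W = V * P * mat_adjoint V"
  have W: "W \<in> carrier_mat d d" "mat_adjoint W = W"
    using Vc P by (auto simp: W_def mat_adjoint_mult[of _ d d _ d] assoc_mult_mat[of _ d d _ d _ d])
  define G where "G = (1 / 2) \<cdot>\<^sub>m (P + W)"
  have G: "G \<in> carrier_mat d d" "mat_adjoint G = G"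
  proof -
    show Gc: "G \<in> carrier_mat d d" using P W by (simp add: G_def)
    show "mat_adjoint G = G"
    proof (rule eq_matI)
      fix i j assume "i < dim_row G" "j < dim_col G"
      then have ij: "i < d" "j < d" using Gc by auto
      have "P $$ (i,j) = cnj (P $$ (j,i))" "W $$ (i,j) = cnj (W $$ (j,i))"
        using ij P W by (metis carrier_matD index_mat_adjoint)+
      then show "mat_adjoint G $$ (i,j) = G $$ (i,j)" using ij P W Gc by (simp add: G_def)
    qed (use Gc in auto)
  qed
  define R where "R = abs_mat X"
  have "hermitian_mat d R" using abs_mat_contraction(2)[OF Xc] by (simp add: R_def)
  then have R: "R \<in> carrier_mat d d" "mat_adjoint R = R" by (auto simp: hermitian_mat_def)
  have "psd_mat d (G - R)"
  proof (rule psd_matI)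
    show "G - R \<in> carrier_mat d d" using R by (simp add: minus_carrier_mat)
    show "mat_adjoint (G - R) = G - R"
    proof (rule eq_matI)
      fix i j assume "i < dim_row (G - R)" "j < dim_col (G - R)"
      then have ij: "i < d" "j < d" using R by auto
      have "G $$ (i,j) = cnj (G $$ (j,i))" "R $$ (i,j) = cnj (R $$ (j,i))"
        using ij G R by (metis carrier_matD index_mat_adjoint)+
      then show "mat_adjoint (G - R) $$ (i,j) = (G - R) $$ (i,j)" using ij G R by simp
    qed (use R in auto)
    fix x :: "complex vec" assume x: "x \<in> carrier_vec d"
    have c: "P *\<^sub>v x \<in> carrier_vec d" "W *\<^sub>v x \<in> carrier_vec d" "R *\<^sub>v x \<in> carrier_vec d"
      "X *\<^sub>v x \<in> carrier_vec d" "K *\<^sub>v x \<in> carrier_vec d"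
      using P W R Xc K x by auto
    have "(G - R) *\<^sub>v x = complex_of_real (1/2) \<cdot>\<^sub>v (P *\<^sub>v x + W *\<^sub>v x) + complex_of_real (-1) \<cdot>\<^sub>v (R *\<^sub>v x)"
    proof -
      have "G *\<^sub>v x = complex_of_real (1/2) \<cdot>\<^sub>v (P *\<^sub>v x + W *\<^sub>v x)"
        unfolding G_def using P W x
        by (subst smult_mat_mult_vec[of _ d d]) (auto simp: add_mult_distrib_mat_vec[of _ d d])
      moreover have "(G - R) *\<^sub>v x = G *\<^sub>v x - R *\<^sub>v x"
        using G R x by (intro minus_mult_distrib_mat_vec[of _ d d]) auto
      ultimately show ?thesis using c by (intro eq_vecI) auto
    qed
    then have "rip ((G - R) *\<^sub>v x) x = (rip (P *\<^sub>v x) x + rip (W *\<^sub>v x) x) / 2 - rip (R *\<^sub>v x) x"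
      using c x by (simp add: rip_add_left[of _ d] rip_smult_left[of _ d] del: of_real_divide of_real_minus)
    moreover have "rip (R *\<^sub>v x) x = rip (X *\<^sub>v x) (K *\<^sub>v x)"
    proof -
      have "R *\<^sub>v x = mat_adjoint K *\<^sub>v (X *\<^sub>v x)"
        unfolding R_def KX[symmetric] using K' Xc x by (rule assoc_mult_mat_vec)
      then show ?thesis using rip_adjoint[OF K' c(4) x] by simp
    qed
    ultimately show "0 \<le> rip ((G - R) *\<^sub>v x) x"
      using block[OF x c(5)] Zx[OF x] ZV[OF x] by (simp add: W_def)
  qed
  then have "loewner_le d R G"
    using G R by (simp add: loewner_le_def hermitian_mat_def)
  then show ?thesis using V by (auto simp: R_def X_def T_def G_def W_def)
qed

end

section \<open>Reduction to inequalities between eigenvalues\<close>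

theorem corollary2p4:
  fixes n d :: nat
    and A B :: "complex mat"
    and \<Phi> :: "complex mat \<Rightarrow> complex mat"
  assumes "concave_monotone_pair n A B"
    and "linear_mat_map n d \<Phi>"
    and "positive_mat_map n d \<Phi>"
    and "unital_mat_map n d \<Phi>"
  shows "\<exists>V. unitary_mat d V \<and>
           loewner_le d (abs_mat (\<Phi> A * \<Phi> B))
             ((1 / 2) \<cdot>\<^sub>m (\<Phi> (A * B) + V * \<Phi> (A * B) * mat_adjoint V))"
proof -
  obtain C g h where C: "psd_mat n C" and g: "g \<in> {0..} \<rightarrow> {0..}" and B: "B = fun_calc g C"
    and h: "h \<in> {0..} \<rightarrow> {0..}" "concave_on {0..} h" and A: "A = fun_calc h B"
    using assms(1) by (auto simp: concave_monotone_pair_def monotone_pair_def)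
  obtain U c where U: "unitary_mat n U" and Cd: "C = spec_mat n U c" and c: "\<forall>i<n. 0 \<le> c i"
    using psd_spectral[OF C] by auto
  interpret positive_linear_map n d \<Phi> U
    using assms(2-4) U by unfold_locales
  \<comment> \<open>The eigenbasis of \<open>C\<close> also diagonalises \<open>B = g(C)\<close> and
    \<open>A = h(B)\<close>; \<open>b\<close> and \<open>a\<close> list their eigenvalues.\<close>
  define b where "b = (\<lambda>i. g (c i))"
  define a where "a = (\<lambda>i. h (b i))"
  have b0: "0 \<le> b i" if "i < n" for i using g c that by (auto simp: b_def)
  have a0: "0 \<le> a i" if "i < n" for i using h(1) b0[OF that] by (auto simp: a_def)
  have Bd: "B = spec_mat n U b" by (simp add: B Cd fun_calc_spec_mat[OF U] b_def)
  have Ad: "A = spec_mat n U a" by (simp add: A Bd fun_calc_spec_mat[OF U] a_def)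
  have AB: "A * B = spec_mat n U (\<lambda>i. a i * b i)" by (simp add: Ad Bd spec_mat_mult[OF U])
  \<comment> \<open>Monotonicity of \<open>h\<close> orders \<open>a\<close> and its slope bound
    orders \<open>b/a\<close>. If \<open>a i = 0\<close>, the left quotient is 0 and the right one
    is non-negative.\<close>
  have ordered: "b i / a i \<le> b j / a j \<and> a i \<le> a j" if ij: "i < n" "j < n" and le: "b i \<le> b j" for i j
  proof
    show a: "a i \<le> a j" using concave_nonneg_mono[OF h b0[OF ij(1)] le] by (simp add: a_def)
    have "b i * a j \<le> b j * a i" using concave_nonneg_slope[OF h b0[OF ij(1)] le] by (simp add: a_def)
    then show "b i / a i \<le> b j / a j"
      using a a0[OF ij(1)] a0[OF ij(2)] b0[OF ij(2)]
      by (cases "a i = 0") (auto simp: divide_le_eq le_divide_eq mult.commute)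
  qed
  have chain: "(b i / a i \<le> b j / a j \<and> a i \<le> a j) \<or> (b j / a j \<le> b i / a i \<and> a j \<le> a i)"
    if "i < n" "j < n" for i j
    using ordered[of i j] ordered[of j i] that by (cases "b i \<le> b j") auto
  have zero: "(\<forall>i<n. a i = 0) \<or> (\<forall>i<n. a i = 0 \<longrightarrow> b i = 0)"
  proof (rule disjCI)
    assume "\<not> (\<forall>i<n. a i = 0 \<longrightarrow> b i = 0)"
    then obtain i where i: "i < n" "h (b i) = 0" "b i \<noteq> 0" by (auto simp: a_def)
    then have "0 < b i" using b0[OF i(1)] by simp
    then show "\<forall>i<n. a i = 0" using concave_nonneg_zero[OF h _ i(2)] b0 by (simp add: a_def)
  qed
  show ?thesis
    \<comment> \<open>\<open>AB\<close> goes first, while the product is still visible, so that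
      \<open>\<Phi> (A * B)\<close> becomes a single value of \<open>F\<close>.\<close>
    unfolding AB unfolding Ad Bd F_def[symmetric] by (rule abs_product_le[OF a0 b0 chain zero])
qed

end
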